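(* Assume that $a_i\le i^{-\alpha+o(1)}$ as $i\to\infty$ for some $\alpha\in(0,1]$. Then, almost surely, the random tree $\mathcal T$ built by aggregation from the sequence $(a_i)_{i\ge1}$ is compact and its Hausdorff dimension is at most $\alpha^{-1}$.
   Context: Let $\mathbf a=(a_i)_{i\ge 1}$ be a (deterministic) sequence of positive real numbers. The random trees $(\mathcal T_n)_{n\ge1}$ are built as follows: $\mathcal T_1$ is a closed segment of length $a_1$, rooted at one of its ends $\rho$; recursively, conditionally on $\mathcal T_1,\dots,\mathcal T_n$, pick a point of $\mathcal T_n$ uniformly (according to the length measure on $\mathcal T_n$ normalized to be a probability) and obtain $\mathcal T_{n+1}$ by gluing one end of a new closed segment ("branch") of length $a_{n+1}$ at this point. Concretely, $\mathcal T_1=\{(x,0,0,\dots):x\in[0,a_1]\}\subset\ell^1(\mathbb R)$ and $\mathcal T_{n+1}=\mathcal T_n\cup\{(u_1,\dots,u_n,x,0,0,\dots):x\in[0,a_{n+1}]\}$ where $(u_1,\dots,u_n,0,\dots)$ is the uniform point of $\mathcal T_n$. The tree $\mathcal T$ is the completion (closure in $\ell^1(\mathbb R)$) of the increasing union $\bigcup_n\mathcal T_n$, endowed with its length metric. Notation: $a_i\le i^{-\alpha+o(1)}$ means that for every $\varepsilon>0$, $a_i\le i^{-\alpha+\varepsilon}$ for all $i$ large enough. *)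

theory Defs
  imports "HOL-Probability.Probability"
begin

section \<open>The space of absolutely summable real sequences\<close>

typedef ell1 = "{x :: nat \<Rightarrow> real. summable (\<lambda>i. \<bar>x i\<bar>)}"
  morphisms coord Abs_ell1
  by (rule exI[of _ "\<lambda>_. 0"]) simp

lemma summable_coord: "summable (\<lambda>i. \<bar>coord x i\<bar>)"
  using coord[of x] by simp

lemma coord_Abs: "summable (\<lambda>i. \<bar>f i\<bar>) \<Longrightarrow> coord (Abs_ell1 f) = f"
  by (simp add: Abs_ell1_inverse)

lemma ell1_eqI: "(\<And>i. coord x i = coord y i) \<Longrightarrow> x = y"
  by (metis coord_inject ext)

instantiation ell1 :: real_vector
begin

definition zero_ell1 :: ell1 where "0 = Abs_ell1 (\<lambda>_. 0)"
definition plus_ell1 :: "ell1 \<Rightarrow> ell1 \<Rightarrow> ell1" where "x + y = Abs_ell1 (\<lambda>i. coord x i + coord y i)"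
definition uminus_ell1 :: "ell1 \<Rightarrow> ell1" where "- x = Abs_ell1 (\<lambda>i. - coord x i)"
definition minus_ell1 :: "ell1 \<Rightarrow> ell1 \<Rightarrow> ell1" where "x - y = Abs_ell1 (\<lambda>i. coord x i - coord y i)"
definition scaleR_ell1 :: "real \<Rightarrow> ell1 \<Rightarrow> ell1" where "c *\<^sub>R x = Abs_ell1 (\<lambda>i. c * coord x i)"

lemma coord_zero [simp]: "coord 0 i = 0"
  by (simp add: zero_ell1_def coord_Abs)

lemma coord_plus [simp]: "coord (x + y) i = coord x i + coord y i"
proof -
  have "summable (\<lambda>i. \<bar>coord x i + coord y i\<bar>)"
    by (rule summable_comparison_test'[OF summable_add[OF summable_coord[of x] summable_coord[of y]], of 0])
       auto
  then show ?thesis by (simp add: plus_ell1_def coord_Abs)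
qed

lemma coord_uminus [simp]: "coord (- x) i = - coord x i"
  by (simp add: uminus_ell1_def coord_Abs summable_coord)

lemma coord_minus [simp]: "coord (x - y) i = coord x i - coord y i"
proof -
  have "summable (\<lambda>i. \<bar>coord x i - coord y i\<bar>)"
    by (rule summable_comparison_test'[OF summable_add[OF summable_coord[of x] summable_coord[of y]], of 0])
       auto
  then show ?thesis by (simp add: minus_ell1_def coord_Abs)
qed

lemma coord_scaleR [simp]: "coord (c *\<^sub>R x) i = c * coord x i"
  by (simp add: scaleR_ell1_def coord_Abs abs_mult summable_coord summable_mult)

instance
  by standard (rule ell1_eqI, simp add: algebra_simps)+

end

instantiation ell1 :: real_normed_vector
begin

definition norm_ell1 :: "ell1 \<Rightarrow> real" where "norm (x :: ell1) = (\<Sum>i. \<bar>coord x i\<bar>)"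
definition sgn_ell1 :: "ell1 \<Rightarrow> ell1" where "sgn (x :: ell1) = x /\<^sub>R norm x"
definition dist_ell1 :: "ell1 \<Rightarrow> ell1 \<Rightarrow> real" where "dist (x :: ell1) y = norm (x - y)"
definition uniformity_ell1 :: "(ell1 \<times> ell1) filter"
  where "uniformity_ell1 = (INF e\<in>{0<..}. principal {(x, y). dist x y < e})"
definition open_ell1 :: "ell1 set \<Rightarrow> bool"
  where "open_ell1 U \<longleftrightarrow> (\<forall>x\<in>U. eventually (\<lambda>(x', y). x' = x \<longrightarrow> y \<in> U) uniformity)"

instance
proof
  fix x y :: ell1 and c :: real
  show "sgn x = x /\<^sub>R norm x"
    by (rule sgn_ell1_def)
  show "dist x y = norm (x - y)"
    by (rule dist_ell1_def)
  show "(uniformity :: (ell1 \<times> ell1) filter) = (INF e\<in>{0<..}. principal {(x, y). dist x y < e})"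
    by (rule uniformity_ell1_def)
  show "open U \<longleftrightarrow> (\<forall>x\<in>U. \<forall>\<^sub>F (x', y) in uniformity. x' = x \<longrightarrow> y \<in> U)" for U :: "ell1 set"
    by (rule open_ell1_def)
  show "norm x = 0 \<longleftrightarrow> x = 0"
  proof
    assume "norm x = 0"
    then have "\<forall>i. \<bar>coord x i\<bar> = 0"
      using suminf_eq_zero_iff[OF summable_coord[of x]] by (simp add: norm_ell1_def)
    then show "x = 0" by (intro ell1_eqI) simp
  qed (simp add: norm_ell1_def)
  have "(\<Sum>i. \<bar>coord x i + coord y i\<bar>) \<le> (\<Sum>i. \<bar>coord x i\<bar> + \<bar>coord y i\<bar>)"
    by (rule suminf_le[OF abs_triangle_ineq])
       (use summable_coord[of "x + y"] summable_add[OF summable_coord[of x] summable_coord[of y]] in simp_all)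
  then show "norm (x + y) \<le> norm x + norm y"
    by (simp add: norm_ell1_def suminf_add[OF summable_coord summable_coord])
  show "norm (c *\<^sub>R x) = \<bar>c\<bar> * norm x"
    by (simp add: norm_ell1_def abs_mult suminf_mult[OF summable_coord])
qed

end

definition unit_vec :: "nat \<Rightarrow> ell1"
  where "unit_vec n = Abs_ell1 (\<lambda>i. if i = n then 1 else 0)"

lemma coord_unit_vec: "coord (unit_vec n) i = (if i = n then 1 else 0)"
proof -
  have "summable (\<lambda>i. \<bar>if i = n then 1 else 0 :: real\<bar>)"
    by (rule summable_finite[of "{n}"]) auto
  then show ?thesis by (simp add: unit_vec_def coord_Abs)
qed

lemma norm_unit_vec [simp]: "norm (unit_vec n) = 1"
proof -
  have "(\<Sum>i. \<bar>coord (unit_vec n) i\<bar>) = (\<Sum>i\<in>{n}. \<bar>coord (unit_vec n) i\<bar>)"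
    by (rule suminf_finite) (auto simp: coord_unit_vec)
  then show ?thesis by (simp add: norm_ell1_def coord_unit_vec)
qed

lemma abs_coord_le_norm: "\<bar>coord x i\<bar> \<le> norm x"
  using sum_le_suminf[OF summable_coord[of x], of "{i}"] by (simp add: norm_ell1_def)

text \<open>Completeness, so that closures in \<^typ>\<open>ell1\<close> are indeed completions.\<close>

instance ell1 :: banach
proof
  fix X :: "nat \<Rightarrow> ell1"
  assume X: "Cauchy X"
  have "Cauchy (\<lambda>n. coord (X n) i)" for i
  proof (rule metric_CauchyI)
    fix e :: real assume "0 < e"
    with X obtain N where N: "\<And>m n. m \<ge> N \<Longrightarrow> n \<ge> N \<Longrightarrow> dist (X m) (X n) < e"
      by (meson metric_CauchyD)
    have "dist (coord (X m) i) (coord (X n) i) < e" if "m \<ge> N" "n \<ge> N" for m n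
      using N[OF that] abs_coord_le_norm[of "X m - X n" i] by (simp add: dist_norm)
    then show "\<exists>N. \<forall>m\<ge>N. \<forall>n\<ge>N. dist (coord (X m) i) (coord (X n) i) < e" by blast
  qed
  then have "\<forall>i. \<exists>l. (\<lambda>n. coord (X n) i) \<longlonglongrightarrow> l"
    unfolding Cauchy_convergent_iff convergent_def by blast
  from choice[OF this] obtain f where f: "\<And>i. (\<lambda>n. coord (X n) i) \<longlonglongrightarrow> f i"
    by blast
  have tail: "\<exists>N. \<forall>m\<ge>N. summable (\<lambda>i. \<bar>coord (X m) i - f i\<bar>) \<and> (\<Sum>i. \<bar>coord (X m) i - f i\<bar>) \<le> e"
    if "0 < e" for e :: real
  proof -
    from X that obtain N where N: "\<And>m n. m \<ge> N \<Longrightarrow> n \<ge> N \<Longrightarrow> dist (X m) (X n) < e"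
      by (meson metric_CauchyD)
    have fin: "(\<Sum>i<K. \<bar>coord (X m) i - f i\<bar>) \<le> e" if m: "m \<ge> N" for m K
    proof (rule LIMSEQ_le_const2)
      show "(\<lambda>n. \<Sum>i<K. \<bar>coord (X m) i - coord (X n) i\<bar>) \<longlonglongrightarrow> (\<Sum>i<K. \<bar>coord (X m) i - f i\<bar>)"
        by (intro tendsto_intros f)
      have "(\<Sum>i<K. \<bar>coord (X m) i - coord (X n) i\<bar>) \<le> e" if "n \<ge> N" for n
        using sum_le_suminf[OF summable_coord[of "X m - X n"], of "{..<K}"] N[OF m that]
        by (simp add: dist_norm norm_ell1_def)
      then show "\<exists>N. \<forall>n\<ge>N. (\<Sum>i<K. \<bar>coord (X m) i - coord (X n) i\<bar>) \<le> e" by blast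
    qed
    have "summable (\<lambda>i. \<bar>coord (X m) i - f i\<bar>)" if "m \<ge> N" for m
      by (rule bounded_imp_summable[where B = e])
         (use fin[OF that] in \<open>auto simp: lessThan_Suc_atMost[symmetric] simp del: sum.lessThan_Suc\<close>)
    moreover from this have "(\<Sum>i. \<bar>coord (X m) i - f i\<bar>) \<le> e" if "m \<ge> N" for m
      using fin[OF that] that by (intro suminf_le_const) auto
    ultimately show ?thesis by blast
  qed
  obtain m where m: "summable (\<lambda>i. \<bar>coord (X m) i - f i\<bar>)"
    using tail[of 1] by auto
  have "summable (\<lambda>i. \<bar>f i\<bar>)"
    by (rule summable_comparison_test'[OF summable_add[OF m summable_coord[of "X m"]], of 0]) auto
  then have cf: "coord (Abs_ell1 f) = f" by (rule coord_Abs)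
  have "X \<longlonglongrightarrow> Abs_ell1 f"
  proof (rule metric_LIMSEQ_I)
    fix e :: real assume "0 < e"
    then obtain N where "\<forall>m\<ge>N. (\<Sum>i. \<bar>coord (X m) i - f i\<bar>) \<le> e / 2"
      using tail[of "e / 2"] by auto
    with \<open>0 < e\<close> show "\<exists>N. \<forall>m\<ge>N. dist (X m) (Abs_ell1 f) < e"
      by (intro exI[of _ N]) (fastforce simp: dist_norm norm_ell1_def cf)
  qed
  then show "convergent X" by (auto simp: convergent_def)
qed


section \<open>Length metric of a subset of a metric space\<close>

definition curve_length :: "(real \<Rightarrow> 'a::metric_space) \<Rightarrow> ennreal" where
  "curve_length g =
     (SUP (n, t) \<in> {(n :: nat, t :: nat \<Rightarrow> real). mono t \<and> range t \<subseteq> {0..1}}.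
        ennreal (\<Sum>i<n. dist (g (t i)) (g (t (Suc i)))))"

text \<open>The value is meaningful for points that some rectifiable curve in \<open>S\<close> joins
  (otherwise it is \<open>0\<close>); almost surely any two points of the trees below are of this kind.\<close>

definition length_dist :: "'a::metric_space set \<Rightarrow> 'a \<Rightarrow> 'a \<Rightarrow> real" where
  "length_dist S x y =
     enn2real (INF g \<in> {g. path g \<and> path_image g \<subseteq> S \<and> pathstart g = x \<and> pathfinish g = y}.
       curve_length g)"


section \<open>Hausdorff dimension of a set \<open>X\<close> with a metric \<open>d\<close>\<close>

definition mdiam :: "('a \<Rightarrow> 'a \<Rightarrow> real) \<Rightarrow> 'a set \<Rightarrow> ennreal" where
  "mdiam d A = (SUP x\<in>A. SUP y\<in>A. ennreal (d x y))"

text \<open>The \<open>s\<close>-th power of the diameter, with \<open>0\<^sup>0 = 1\<close> for nonempty sets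
  (whereas \<^term>\<open>0 powr 0 = (0 :: real)\<close>). It is only applied to sets of finite diameter.\<close>

definition diam_powr :: "('a \<Rightarrow> 'a \<Rightarrow> real) \<Rightarrow> real \<Rightarrow> 'a set \<Rightarrow> ennreal" where
  "diam_powr d s A =
     (if A = {} then 0 else if s = 0 then 1 else ennreal (enn2real (mdiam d A) powr s))"

definition hausdorff_premeasure :: "'a set \<Rightarrow> ('a \<Rightarrow> 'a \<Rightarrow> real) \<Rightarrow> real \<Rightarrow> real \<Rightarrow> ennreal" where
  "hausdorff_premeasure X d s \<delta> =
     (INF C \<in> {C :: nat \<Rightarrow> 'a set. X \<subseteq> (\<Union>i. C i) \<and> (\<forall>i. C i \<subseteq> X \<and> mdiam d (C i) \<le> ennreal \<delta>)}.
        \<Sum>i. diam_powr d s (C i))"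

definition hausdorff_measure :: "'a set \<Rightarrow> ('a \<Rightarrow> 'a \<Rightarrow> real) \<Rightarrow> real \<Rightarrow> ennreal" where
  "hausdorff_measure X d s = (SUP \<delta>\<in>{0<..}. hausdorff_premeasure X d s \<delta>)"

definition hausdorff_dim :: "'a set \<Rightarrow> ('a \<Rightarrow> 'a \<Rightarrow> real) \<Rightarrow> ennreal" where
  "hausdorff_dim X d = (INF s \<in> {s. 0 \<le> s \<and> hausdorff_measure X d s = 0}. ennreal s)"


section \<open>Trees built by aggregation\<close>

text \<open>
  Here \<open>u n\<close>, for \<open>n \<ge> 1\<close>, is the point of the \<open>n\<close>-th tree at which branch \<open>n + 1\<close> is glued;
  the first branch starts at the root \<open>0\<close>. Lengths \<open>a i\<close> and glueing points \<open>u n\<close> are indexed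
  from \<open>1\<close> (their values at \<open>0\<close> are irrelevant), coordinates from \<open>0\<close>, so that branch \<open>Suc n\<close>
  has direction \<^term>\<open>unit_vec n\<close>, while the \<open>n\<close>-th tree only uses the coordinates \<open>i < n\<close>.
\<close>

definition glue_point :: "(nat \<Rightarrow> ell1) \<Rightarrow> nat \<Rightarrow> ell1" where
  "glue_point u n = (if n = 0 then 0 else u n)"

definition branch_point :: "(nat \<Rightarrow> ell1) \<Rightarrow> nat \<Rightarrow> real \<Rightarrow> ell1" where
  "branch_point u n x = glue_point u n + x *\<^sub>R unit_vec n"

text \<open>Stage \<open>0\<close> is the bare root.\<close>

primrec agg_tree :: "(nat \<Rightarrow> real) \<Rightarrow> (nat \<Rightarrow> ell1) \<Rightarrow> nat \<Rightarrow> ell1 set" where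
  "agg_tree a u 0 = {0}"
| "agg_tree a u (Suc n) = agg_tree a u n \<union> branch_point u n ` {0..a (Suc n)}"

lemma agg_tree_1: "agg_tree a u 1 = {x *\<^sub>R unit_vec 0 | x. 0 \<le> x \<and> x \<le> a 1}" if "a 1 > 0"
  using that by (force simp: branch_point_def glue_point_def)

definition limit_tree :: "(nat \<Rightarrow> real) \<Rightarrow> (nat \<Rightarrow> ell1) \<Rightarrow> ell1 set" where
  "limit_tree a u = closure (\<Union>n\<in>{1..}. agg_tree a u n)"

text \<open>The length measure on the \<open>n\<close>-th tree: the sum of the Lebesgue measures on its branches.\<close>

definition length_measure :: "(nat \<Rightarrow> real) \<Rightarrow> (nat \<Rightarrow> ell1) \<Rightarrow> nat \<Rightarrow> ell1 measure" where
  "length_measure a u n = measure_of UNIV (sets borel)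
     (\<lambda>B. \<Sum>i<n. emeasure lborel ({0..a (Suc i)} \<inter> branch_point u i -` B))"

lemma sets_length_measure [simp, measurable_cong]: "sets (length_measure a u n) = sets borel"
  using sets.sigma_sets_eq[of "borel :: ell1 measure"] by (simp add: length_measure_def)

lemma space_length_measure [simp]: "space (length_measure a u n) = UNIV"
  by (simp add: length_measure_def)

lemma branch_point_measurable: "branch_point u i \<in> borel_measurable borel"
  unfolding branch_point_def by (intro borel_measurable_continuous_onI continuous_intros)

lemma emeasure_length_measure:
  assumes B: "B \<in> sets borel"
  shows "emeasure (length_measure a u n) B
    = (\<Sum>i<n. emeasure lborel ({0..a (Suc i)} \<inter> branch_point u i -` B))"
proof (rule emeasure_measure_of[OF length_measure_def])
  let ?\<mu> = "\<lambda>B. \<Sum>i<n. emeasure lborel ({0..a (Suc i)} \<inter> branch_point u i -` B)"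
  have vim: "{0..a (Suc i)} \<inter> branch_point u i -` A \<in> sets lborel" if "A \<in> sets borel" for i A
    using measurable_sets[OF branch_point_measurable that, of u i] by simp
  show "positive (sets (length_measure a u n)) ?\<mu>"
    by (simp add: positive_def)
  show "countably_additive (sets (length_measure a u n)) ?\<mu>"
  proof (rule countably_additiveI)
    fix A :: "nat \<Rightarrow> ell1 set"
    assume A: "range A \<subseteq> sets (length_measure a u n)" "disjoint_family A"
    have eq: "(\<Sum>j. emeasure lborel ({0..a (Suc i)} \<inter> branch_point u i -` A j))
      = emeasure lborel ({0..a (Suc i)} \<inter> branch_point u i -` (\<Union>j. A j))" for i
    proof -
      have "disjoint_family (\<lambda>j. {0..a (Suc i)} \<inter> branch_point u i -` A j)"
        using A(2) by (auto simp: disjoint_family_on_def)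
      then have "(\<Sum>j. emeasure lborel ({0..a (Suc i)} \<inter> branch_point u i -` A j))
        = emeasure lborel (\<Union>j. {0..a (Suc i)} \<inter> branch_point u i -` A j)"
        using A(1) by (intro suminf_emeasure) (use vim in \<open>auto simp: image_subset_iff\<close>)
      also have "(\<Union>j. {0..a (Suc i)} \<inter> branch_point u i -` A j)
        = {0..a (Suc i)} \<inter> branch_point u i -` (\<Union>j. A j)" by auto
      finally show ?thesis .
    qed
    have "(\<Sum>j. ?\<mu> (A j)) = (\<Sum>i<n. \<Sum>j. emeasure lborel ({0..a (Suc i)} \<inter> branch_point u i -` A j))"
      by (rule suminf_sum) simp
    then show "(\<Sum>j. ?\<mu> (A j)) = ?\<mu> (\<Union>j. A j)" by (simp add: eq)
  qed
qed (use B in auto)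

definition uniform_on_tree :: "(nat \<Rightarrow> real) \<Rightarrow> (nat \<Rightarrow> ell1) \<Rightarrow> nat \<Rightarrow> ell1 measure" where
  "uniform_on_tree a u n = uniform_measure (length_measure a u n) (agg_tree a u n)"

text \<open>The information carried by the trees \<open>1, \<dots>, n\<close>, that is, by the glueing points
  \<open>U 1, \<dots>, U (n - 1)\<close>.\<close>

definition past :: "'w measure \<Rightarrow> (nat \<Rightarrow> 'w \<Rightarrow> ell1) \<Rightarrow> nat \<Rightarrow> 'w measure" where
  "past M U n = sigma (space M) {U k -` B \<inter> space M | k B. 1 \<le> k \<and> k < n \<and> B \<in> sets borel}"

text \<open>
  \<open>U 1, U 2, \<dots>\<close> are the glueing points of the random aggregation with branch lengths \<open>a\<close>:
  conditionally on the trees \<open>1, \<dots>, n\<close>, the point \<open>U n\<close> is uniform on the \<open>n\<close>-th tree.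
\<close>

locale aggregation = prob_space M
  for M :: "'w measure" and a :: "nat \<Rightarrow> real" and U :: "nat \<Rightarrow> 'w \<Rightarrow> ell1" +
  assumes length_pos: "\<And>i. i \<ge> 1 \<Longrightarrow> a i > 0"
    and glue_measurable: "\<And>n. n \<ge> 1 \<Longrightarrow> U n \<in> borel_measurable M"
    and glue_uniform: "\<And>n B. n \<ge> 1 \<Longrightarrow> B \<in> sets borel \<Longrightarrow>
      AE \<omega> in M. real_cond_exp M (past M U n) (indicator (U n -` B \<inter> space M)) \<omega>
        = measure (uniform_on_tree a (\<lambda>k. U k \<omega>) n) B"

end

theory Submission
  imports Defs "HOL-Real_Asymp.Real_Asymp"
begin

text \<open>
Everything rests on reading the genealogy of a point of the tree off its coordinates in \<open>\<ell>\<^sup>1\<close>: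
coordinate \<open>n\<close> equals \<open>s > 0\<close> exactly when the path from the root to the point runs along a piece of
length \<open>s\<close> of branch \<open>n + 1\<close>. So the number of its nonzero coordinates is its generation, a
\<^emph>\<open>deterministic\<close> Borel function of the point, and the norm is the height.

\<^bold>\<open>Generations are logarithmic.\<close> Write \<open>A\<^sub>n = a\<^sub>1 + \<dots> + a\<^sub>n\<close> and let \<open>G\<^sub>n\<close> be the generation of the
\<open>n\<close>-th gluing point. Choosing a uniform point means choosing a branch with probability proportional
to its length, which gives \<open>A\<^sub>n E 2\<^bsup>G\<^sub>n\<^esup> = \<Sum>\<^bsub>i<n\<^esub> a\<^bsub>i+1\<^esub> 2 E 2\<^bsup>G\<^sub>i\<^esup>\<close>, and hence
\<open>E 2\<^bsup>G\<^sub>n\<^esup> \<le> 2 A\<^sub>n / a\<^sub>1\<close> (\<open>expectation_power_gen_le\<close>). As \<open>A\<^sub>n\<close> grows at most linearly, the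
series of \<open>2\<^bsup>G\<^sub>n\<^esup> / n\<^sup>3\<close> has a finite mean, so almost surely \<open>2\<^bsup>G\<^sub>n\<^esup> \<le> C n\<^sup>3\<close> for all \<open>n\<close>
(\<open>AE_gen_growth\<close>).

\<^bold>\<open>The trees converge fast.\<close> The rest is deterministic. Let \<open>\<beta> < \<gamma> < \<alpha>\<close>. The branches on the path
to a given point have pairwise distinct generations \<open>k\<close>, and one that is glued on the \<open>i\<close>-th tree,
\<open>i \<ge> n\<close>, has length at most a constant times \<open>i\<^bsup>-\<gamma>\<^esup> \<le> n\<^bsup>-\<beta>\<^esup> i\<^bsup>-(\<gamma>-\<beta>)\<^esup>\<close>, whose last factor decays
geometrically in \<open>k\<close> by the previous estimate. A geometric series therefore bounds the distance from
any point of the limit tree to the \<open>n\<close>-th tree by \<open>K n\<^bsup>-\<beta>\<^esup>\<close> (\<open>uniform_tail_bound\<close>).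

\<^bold>\<open>Compactness and dimension.\<close> Cutting the first \<open>n\<close> branches into pieces of length \<open>n\<^bsup>-\<beta>\<^esup>\<close>
yields \<open>O(n log n)\<close> balls of radius \<open>O(n\<^bsup>-\<beta>\<^esup>)\<close> that cover the limit tree (\<open>limit_tree_cover\<close>). It is
closed and totally bounded, thus compact, and its \<open>s\<close>-dimensional Hausdorff measure vanishes as soon
as \<open>\<beta> s > 1\<close> for some \<open>\<beta> < \<alpha>\<close>, that is, for every \<open>s > 1 / \<alpha>\<close>.

\<^bold>\<open>The metric.\<close> These estimates are made in the norm of \<open>\<ell>\<^sup>1\<close>, and they carry over because two points
of the limit tree are joined in it by a path whose length is their \<open>\<ell>\<^sup>1\<close>-distance
(\<open>geodesic_exists\<close>), so that the length metric is the one induced by the norm.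
\<close>

section \<open>Truncation and a countable dense set\<close>

lemma coord_sum: "coord (\<Sum>i\<in>I. f i) j = (\<Sum>i\<in>I. coord (f i) j)"
  by (induction I rule: infinite_finite_induct) auto

lemma bounded_linear_coord: "bounded_linear (\<lambda>x. coord x i)"
  by (rule bounded_linear_intro[of _ 1]) (auto simp: abs_coord_le_norm)

lemmas continuous_on_coord [continuous_intros] = bounded_linear.continuous_on[OF bounded_linear_coord]

lemma measurable_coord [measurable]: "(\<lambda>x. coord x i) \<in> borel_measurable borel"
  by (intro borel_measurable_continuous_onI continuous_intros)

definition trunc :: "nat \<Rightarrow> ell1 \<Rightarrow> ell1" where
  "trunc n x = (\<Sum>i<n. coord x i *\<^sub>R unit_vec i)"

lemma coord_trunc [simp]: "coord (trunc n x) j = (if j < n then coord x j else 0)"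
  by (simp add: trunc_def coord_sum coord_unit_vec if_distrib sum.delta cong: if_cong)

lemma continuous_on_trunc [continuous_intros]:
  "continuous_on S f \<Longrightarrow> continuous_on S (\<lambda>x. trunc n (f x))"
  unfolding trunc_def by (intro continuous_intros)

lemma trunc_eq_self: "(\<And>j. j \<ge> n \<Longrightarrow> coord x j = 0) \<Longrightarrow> trunc n x = x"
  by (rule ell1_eqI) (simp add: not_less)

lemma norm_le_of_partial_sums:
  assumes "\<And>n. (\<Sum>i<n. \<bar>coord x i\<bar>) \<le> B"
  shows "norm x \<le> B"
  unfolding norm_ell1_def by (rule suminf_le_const[OF summable_coord assms])

lemma trunc_tendsto: "(\<lambda>n. trunc n x) \<longlonglongrightarrow> x"
proof -
  have "norm (x - trunc n x) = (\<Sum>i. \<bar>coord x (i + n)\<bar>)" for n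
  proof -
    have "norm (x - trunc n x) = (\<Sum>i. \<bar>coord (x - trunc n x) (i + n)\<bar>) +
        (\<Sum>i<n. \<bar>coord (x - trunc n x) i\<bar>)"
      unfolding norm_ell1_def by (rule suminf_split_initial_segment[OF summable_coord])
    then show ?thesis by simp
  qed
  moreover have "(\<lambda>n. \<Sum>i. \<bar>coord x (i + n)\<bar>) \<longlonglongrightarrow> 0"
    by (rule suminf_exist_split2[OF summable_coord])
  ultimately have "(\<lambda>n. norm (trunc n x - x)) \<longlonglongrightarrow> 0"
    by (simp add: norm_minus_commute)
  then show ?thesis by (simp add: tendsto_norm_zero_iff LIM_zero_iff)
qed

text \<open>
A countable dense set. It reduces the assertion that the gluing point lies on a random closed set to
countably many deterministic balls.
\<close>

definition rat_points :: "ell1 set" where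
  "rat_points = range (\<lambda>qs :: rat list. \<Sum>i<length qs. of_rat (qs ! i) *\<^sub>R unit_vec i)"

lemma countable_rat_points: "countable rat_points"
  unfolding rat_points_def by simp

lemma rat_points_dense:
  assumes "0 < e"
  obtains p where "p \<in> rat_points" "dist p x < e"
proof -
  obtain n where n: "dist (trunc n x) x < e / 2"
    using metric_LIMSEQ_D[OF trunc_tendsto[of x], of "e / 2"] assms by auto
  define \<delta> where "\<delta> = e / (2 * (real n + 1))"
  have "\<exists>q :: rat. \<bar>of_rat q - coord x i\<bar> < \<delta>" for i
  proof -
    have "0 < \<delta>" using assms by (simp add: \<delta>_def)
    then obtain r where r: "r \<in> \<rat>" "coord x i < r" "r < coord x i + \<delta>"
      using Rats_dense_in_real[of "coord x i" "coord x i + \<delta>"] by auto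
    from r(1) obtain q :: rat where "r = of_rat q" by (rule Rats_cases)
    then show ?thesis using r by (intro exI[of _ q]) auto
  qed
  then obtain q :: "nat \<Rightarrow> rat" where q: "\<And>i. \<bar>of_rat (q i) - coord x i\<bar> < \<delta>"
    by metis
  define p where "p = (\<Sum>i<n. (of_rat (q i) :: real) *\<^sub>R unit_vec i)"
  have "dist p (trunc n x) = norm (\<Sum>i<n. (of_rat (q i) - coord x i) *\<^sub>R unit_vec i)"
    by (simp add: p_def trunc_def dist_norm sum_subtractf scaleR_diff_left)
  also have "\<dots> \<le> (\<Sum>i<n. \<bar>of_rat (q i) - coord x i\<bar>)"
    by (rule order_trans[OF norm_sum]) simp
  also have "\<dots> \<le> (\<Sum>i<n. \<delta>)"
    by (intro sum_mono less_imp_le q)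
  also have "\<dots> \<le> e / 2" using assms by (simp add: \<delta>_def field_simps)
  finally have "dist p x < e" using n dist_triangle[of p x "trunc n x"] by simp
  moreover have "p \<in> rat_points" unfolding rat_points_def
    by (rule image_eqI[of _ _ "map q [0..<n]"]) (simp_all add: p_def)
  ultimately show ?thesis using that by blast
qed

section \<open>The number of nonzero coordinates\<close>

text \<open>
On the trees below, this is the generation of a point once \<open>n\<close> is large enough: how many branches
the path from the root uses.
\<close>

definition nnz :: "nat \<Rightarrow> ell1 \<Rightarrow> nat" where
  "nnz n x = (\<Sum>i<n. of_bool (coord x i \<noteq> 0))"

lemma nnz_0 [simp]: "nnz 0 x = 0"
  and nnz_Suc: "nnz (Suc n) x = nnz n x + of_bool (coord x n \<noteq> 0)"
  by (simp_all add: nnz_def)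

lemma nnz_le: "nnz n x \<le> n"
  by (induction n) (auto simp: nnz_Suc)

lemma nnz_trunc [simp]: "nnz n (trunc n x) = nnz n x"
  by (simp add: nnz_def)

lemma nnz_measurable [measurable]: "nnz n \<in> measurable borel (count_space UNIV)"
  unfolding nnz_def by measurable

lemma nnz_eq_of_coord_zero:
  assumes "m \<le> n" "\<And>j. m \<le> j \<Longrightarrow> coord x j = 0"
  shows "nnz n x = nnz m x"
  using assms(1) by (induction n rule: dec_induct) (auto simp: nnz_Suc assms(2))

section \<open>Geometry of a growing tree\<close>

lemma coord_branch_point: "coord (branch_point u n s) i = coord (glue_point u n) i + (if i = n then s else 0)"
  by (simp add: branch_point_def coord_unit_vec)

lemma dist_branch_point: "dist (branch_point u n s) (branch_point u n t) = \<bar>s - t\<bar>"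
  by (simp add: branch_point_def dist_norm flip: scaleR_diff_left)

lemma agg_tree_mono: "m \<le> n \<Longrightarrow> agg_tree a u m \<subseteq> agg_tree a u n"
  by (rule lift_Suc_mono_le[of "agg_tree a u"]) auto

lemma branch_subset_agg_tree: "i < n \<Longrightarrow> branch_point u i ` {0..a (Suc i)} \<subseteq> agg_tree a u n"
  using agg_tree_mono[of "Suc i" n a u] by auto

lemma compact_agg_tree: "compact (agg_tree a u n)"
proof (induction n)
  case (Suc n)
  have "continuous_on {0..a (Suc n)} (branch_point u n)"
    unfolding branch_point_def by (intro continuous_intros)
  then show ?case using Suc by (auto intro: compact_continuous_image)
qed simp

text \<open>
A realisation of the aggregation: every gluing point lies on the tree it is meant for. Almost all
outcomes are of this kind (\<open>AE_growing_tree\<close>), so that the geometry can be studied without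
probability.
\<close>

locale growing_tree =
  fixes a :: "nat \<Rightarrow> real" and u :: "nat \<Rightarrow> ell1"
  assumes length_pos: "i \<ge> 1 \<Longrightarrow> a i > 0"
    and glue_in_tree: "n \<ge> 1 \<Longrightarrow> u n \<in> agg_tree a u n"
begin

abbreviation T :: "ell1 set" where "T \<equiv> limit_tree a u"

lemma glue_point_in_tree: "glue_point u n \<in> agg_tree a u n"
  using glue_in_tree by (auto simp: glue_point_def)

lemma coord_agg_tree_eq_0: "x \<in> agg_tree a u n \<Longrightarrow> n \<le> j \<Longrightarrow> coord x j = 0"
proof (induction n arbitrary: x)
  case (Suc n)
  then show ?case using glue_point_in_tree[of n] by (auto simp: coord_branch_point)
qed simp

lemma coord_glue_point_eq_0: "n \<le> j \<Longrightarrow> coord (glue_point u n) j = 0"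
  by (rule coord_agg_tree_eq_0[OF glue_point_in_tree])

lemma trunc_branch_point: "n \<le> m \<Longrightarrow> trunc n (branch_point u m s) = trunc n (glue_point u m)"
  by (rule ell1_eqI) (simp add: coord_branch_point)

lemma trunc_glue_point [simp]: "trunc n (glue_point u n) = glue_point u n"
  by (rule trunc_eq_self) (rule coord_glue_point_eq_0)

text \<open>
Truncation projects the later trees onto the \<open>n\<close>-th one: it prunes the branches numbered
\<open>n + 1\<close> and above.
\<close>

lemma trunc_agg_tree: "x \<in> agg_tree a u m \<Longrightarrow> trunc n x \<in> agg_tree a u n"
proof (induction m arbitrary: x)
  case 0
  have "trunc n 0 = (0 :: ell1)" by (rule trunc_eq_self) simp
  then show ?case using 0 agg_tree_mono[of 0 n a u] by auto
next
  case (Suc m)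
  show ?case
  proof (cases "Suc m \<le> n")
    case True
    then have "trunc n x = x"
      using coord_agg_tree_eq_0[OF Suc.prems] by (intro trunc_eq_self) auto
    then show ?thesis using Suc.prems agg_tree_mono[OF True, of a u] by auto
  next
    case False
    then have "trunc n (branch_point u m s) \<in> agg_tree a u n" for s
      using Suc.IH[OF glue_point_in_tree] by (simp add: trunc_branch_point)
    then show ?thesis using Suc.prems Suc.IH by auto
  qed
qed

lemma agg_tree_subset: "agg_tree a u n \<subseteq> T"
proof -
  have "agg_tree a u n \<subseteq> agg_tree a u (Suc n)" by auto
  also have "\<dots> \<subseteq> T" unfolding limit_tree_def
    by (rule subset_trans[OF _ closure_subset]) (rule UN_upper, simp)
  finally show ?thesis .
qed

text \<open>
Truncation is continuous and the \<open>n\<close>-th tree is closed, so the projection extends to the limit.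
\<close>

lemma trunc_limit_tree: assumes "x \<in> T" shows "trunc n x \<in> agg_tree a u n"
proof -
  have "trunc n ` closure (\<Union>n\<in>{1..}. agg_tree a u n) \<subseteq> agg_tree a u n"
    using compact_imp_closed[OF compact_agg_tree] trunc_agg_tree
    by (intro image_closure_subset continuous_intros) auto
  then show ?thesis using assms by (auto simp: limit_tree_def)
qed

text \<open>
The three facts that describe the limit tree in coordinates. The last one says that a path can enter
branch \<open>n + 1\<close> only through its gluing point; two points that both have a nonzero coordinate \<open>n\<close>
therefore agree in all previous coordinates.
\<close>

lemma coord_limit_tree:
  assumes "x \<in> T"
  shows coord_nonneg: "0 \<le> coord x n" and coord_le_length: "coord x n \<le> a (Suc n)"
    and trunc_eq_glue_point: "coord x n \<noteq> 0 \<Longrightarrow> trunc n x = glue_point u n"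
proof -
  have "trunc (Suc n) x \<in> agg_tree a u n \<or> trunc (Suc n) x \<in> branch_point u n ` {0..a (Suc n)}"
    using trunc_limit_tree[OF assms, of "Suc n"] by auto
  then have "0 \<le> coord x n \<and> coord x n \<le> a (Suc n) \<and> (coord x n \<noteq> 0 \<longrightarrow> trunc n x = glue_point u n)"
  proof
    assume "trunc (Suc n) x \<in> agg_tree a u n"
    then have "coord (trunc (Suc n) x) n = 0" by (rule coord_agg_tree_eq_0) simp
    then show ?thesis using length_pos[of "Suc n"] by simp
  next
    assume "trunc (Suc n) x \<in> branch_point u n ` {0..a (Suc n)}"
    then obtain s where s: "0 \<le> s" "s \<le> a (Suc n)" "trunc (Suc n) x = branch_point u n s" by auto
    have "coord x n = s"
      using arg_cong[OF s(3), of "\<lambda>y. coord y n"] by (simp add: coord_branch_point coord_glue_point_eq_0)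
    moreover have "trunc n x = trunc n (trunc (Suc n) x)" by (rule ell1_eqI) simp
    ultimately show ?thesis using s by (simp add: trunc_branch_point)
  qed
  then show "0 \<le> coord x n" "coord x n \<le> a (Suc n)"
    "coord x n \<noteq> 0 \<Longrightarrow> trunc n x = glue_point u n" by auto
qed

lemma branch_point_in_limit_tree: "0 \<le> s \<Longrightarrow> s \<le> a (Suc n) \<Longrightarrow> branch_point u n s \<in> T"
  using agg_tree_subset[of "Suc n"] by auto

end

section \<open>The path from the root to a point\<close>

definition psum :: "ell1 \<Rightarrow> nat \<Rightarrow> real" where
  "psum x n = (\<Sum>i<n. coord x i)"

lemma psum_0 [simp]: "psum x 0 = 0" and psum_Suc [simp]: "psum x (Suc n) = psum x n + coord x n"
  by (simp_all add: psum_def)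

text \<open>
The point at height \<open>t\<close> on the path from the root to \<open>x\<close>. The path fills the coordinates of \<open>x\<close> one
after the other, so coordinate \<open>i\<close> is what the first \<open>t\<close> units of length put between the heights
\<open>psum x i\<close> and \<open>psum x (Suc i)\<close>.
\<close>

definition fill :: "ell1 \<Rightarrow> real \<Rightarrow> ell1" where
  "fill x t = Abs_ell1 (\<lambda>i. min t (psum x (Suc i)) - min t (psum x i))"

lemma coord_fill:
  assumes nonneg: "\<And>i. 0 \<le> coord x i"
  shows "coord (fill x t) i = min t (psum x (Suc i)) - min t (psum x i)"
proof -
  have "summable (\<lambda>i. \<bar>min t (psum x (Suc i)) - min t (psum x i)\<bar>)"
    by (rule summable_comparison_test'[OF summable_coord[of x], of 0]) (use nonneg in \<open>auto simp: min_def add_increasing2 dest: order_trans not_le_imp_less\<close>)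
  then show ?thesis by (simp add: fill_def coord_Abs)
qed

lemma psum_mono: "(\<And>i. 0 \<le> coord x i) \<Longrightarrow> m \<le> n \<Longrightarrow> psum x m \<le> psum x n"
  unfolding psum_def by (intro sum_mono2) auto

lemma psum_tendsto_norm: "(\<And>i. 0 \<le> coord x i) \<Longrightarrow> psum x \<longlonglongrightarrow> norm x"
  using summable_LIMSEQ[OF summable_coord[of x]] by (simp add: norm_ell1_def psum_def[abs_def])

lemma psum_le_norm: "(\<And>i. 0 \<le> coord x i) \<Longrightarrow> psum x n \<le> norm x"
  using sum_le_suminf[OF summable_coord[of x], of "{..<n}"] by (simp add: norm_ell1_def psum_def)

lemma fill_norm:
  assumes "\<And>i. 0 \<le> coord x i"
  shows "fill x (norm x) = x"
  using psum_le_norm[OF assms]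
  by (intro ell1_eqI) (simp add: coord_fill assms min_absorb2 del: psum_Suc, simp)

text \<open>
All coordinates of \<open>fill x t\<close> increase with \<open>t\<close>, so the increments add up without
cancellation and telescope.
\<close>

lemma fill_lipschitz:
  assumes nonneg: "\<And>i. 0 \<le> coord x i"
  shows "1-lipschitz_on S (fill x)"
proof (rule lipschitz_on_leI)
  fix s t :: real assume st: "s \<le> t"
  have "norm (fill x t - fill x s) \<le> t - s"
  proof (rule norm_le_of_partial_sums)
    fix n
    have *: "0 \<le> coord (fill x t - fill x s) i" for i
      unfolding coord_minus coord_fill[OF nonneg] using nonneg[of i] st by (auto simp: min_def)
    have "(\<Sum>i<n. \<bar>coord (fill x t - fill x s) i\<bar>) =
        (\<Sum>i<n. (min t (psum x (Suc i)) - min s (psum x (Suc i))) - (min t (psum x i) - min s (psum x i)))"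
      unfolding abs_of_nonneg[OF *] by (simp add: coord_fill nonneg algebra_simps)
    also have "\<dots> = (min t (psum x n) - min s (psum x n)) - (min t 0 - min s 0)"
      by (subst sum_lessThan_telescope) simp
    also have "\<dots> \<le> t - s" using st psum_mono[of x 0 n] nonneg by (auto simp: min_def)
    finally show "(\<Sum>i<n. \<bar>coord (fill x t - fill x s) i\<bar>) \<le> t - s" .
  qed
  then show "dist (fill x s) (fill x t) \<le> 1 * dist s t"
    using st by (simp add: dist_norm norm_minus_commute)
qed simp

context growing_tree
begin

text \<open>
A height below the norm falls in the range of some coordinate \<open>m\<close>, and there the path runs along
branch \<open>m + 1\<close>, at distance \<open>t - psum x m\<close> from its gluing point.
\<close>

lemma fill_in_limit_tree:
  assumes x: "x \<in> T" and t: "0 \<le> t" "t \<le> norm x"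
  shows "fill x t \<in> T"
proof (cases "t = norm x")
  case True
  then show ?thesis using x by (simp add: fill_norm coord_nonneg)
next
  case False
  note nn = coord_nonneg[OF x]
  have "eventually (\<lambda>n. t < psum x n) sequentially"
    using order_tendstoD(1)[OF psum_tendsto_norm[OF nn]] t False by auto
  then obtain n0 where n0: "t < psum x n0" by (auto simp: eventually_sequentially)
  define n where "n = (LEAST n. t < psum x n)"
  have n: "t < psum x n" unfolding n_def using n0 by (rule LeastI)
  then obtain m where m: "n = Suc m" using t by (cases n) auto
  have m': "psum x m \<le> t"
    using not_less_Least[of m "\<lambda>n. t < psum x n"] m unfolding n_def by (simp add: not_less)
  have pos: "coord x m > 0" using n m m' by simp
  have glue: "trunc m x = glue_point u m" using trunc_eq_glue_point[OF x] pos by auto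
  have "fill x t = branch_point u m (t - psum x m)"
  proof (rule ell1_eqI)
    fix i
    have gc: "coord (glue_point u m) i = (if i < m then coord x i else 0)"
      using glue by (metis coord_trunc)
    consider "i < m" | "i = m" | "i > m" by linarith
    then show "coord (fill x t) i = coord (branch_point u m (t - psum x m)) i"
    proof cases
      case 1
      then have "psum x (Suc i) \<le> t" "psum x i \<le> t"
        using psum_mono[OF nn, of "Suc i" m] psum_mono[OF nn, of i m] m' by linarith+
      then show ?thesis using 1 by (simp add: coord_fill nn coord_branch_point gc)
    next
      case 2
      then show ?thesis using m' n m by (simp add: coord_fill nn coord_branch_point coord_glue_point_eq_0)
    next
      case 3
      then have "t \<le> psum x (Suc i)" "t \<le> psum x i"
        using psum_mono[OF nn, of n i] psum_mono[OF nn, of n "Suc i"] m n by linarith+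
      then show ?thesis using 3 by (simp add: coord_fill nn coord_branch_point gc)
    qed
  qed
  moreover have "t - psum x m \<le> a (Suc m)"
    using n m coord_le_length[OF x, of m] by simp
  ultimately show ?thesis using branch_point_in_limit_tree[of "t - psum x m" m] m' by simp
qed

text \<open>
The paths from the root to \<open>x\<close> and \<open>y\<close> separate at height \<open>h\<close>, inside the first coordinate \<open>n\<close>
where the two points differ. Beyond that coordinate their supports are disjoint, because a common
branch would force equal coordinates \<open>n\<close>. So the common part of the two heights is \<open>h\<close>, and the
\<open>\<ell>\<^sup>1\<close>-distance counts exactly the rest.
\<close>

lemma branching_height:
  assumes x: "x \<in> T" and y: "y \<in> T"
  obtains h where "0 \<le> h" "h \<le> norm x" "h \<le> norm y" "fill x h = fill y h"
    "dist x y = (norm x - h) + (norm y - h)"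
proof (cases "x = y")
  case True
  show ?thesis by (rule that[of "norm x"]) (use True in auto)
next
  case False
  note nx = coord_nonneg[OF x] and ny = coord_nonneg[OF y]
  define n where "n = (LEAST n. coord x n \<noteq> coord y n)"
  have "\<exists>n. coord x n \<noteq> coord y n" using False ell1_eqI by blast
  then have n: "coord x n \<noteq> coord y n" unfolding n_def by (rule LeastI_ex)
  have below: "coord x i = coord y i" if "i < n" for i
    using not_less_Least[of i "\<lambda>n. coord x n \<noteq> coord y n"] that by (auto simp: n_def)
  have above: "min (coord x i) (coord y i) = 0" if "i > n" for i
  proof (rule ccontr)
    assume "\<not> ?thesis"
    then have "coord x i \<noteq> 0" "coord y i \<noteq> 0" using nx[of i] ny[of i] by (auto simp: min_def split: if_splits)
    then have "trunc i x = trunc i y"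
      using trunc_eq_glue_point[OF x] trunc_eq_glue_point[OF y] by metis
    then have "coord (trunc i x) n = coord (trunc i y) n" by simp
    then show False using n that by simp
  qed
  have ps: "psum x i = psum y i" if "i \<le> n" for i
    unfolding psum_def using below that by (intro sum.cong) auto
  define h where "h = psum x n + min (coord x n) (coord y n)"
  have hx: "h \<le> psum x (Suc n)" and hy: "h \<le> psum y (Suc n)" using ps[of n] by (auto simp: h_def)
  have h0: "psum x n \<le> h" using nx ny by (simp add: h_def)
  have eq: "fill x h = fill y h"
  proof (rule ell1_eqI)
    fix i
    consider "i < n" | "i = n" | "i > n" by linarith
    then show "coord (fill x h) i = coord (fill y h) i"
    proof cases
      case 1
      then show ?thesis using ps[of i] ps[of "Suc i"] by (simp add: coord_fill nx ny del: psum_Suc)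
    next
      case 2
      then show ?thesis using hx hy ps[of n] by (simp add: coord_fill nx ny del: psum_Suc)
    next
      case 3
      then have "h \<le> psum x i" "h \<le> psum y i" "h \<le> psum x (Suc i)" "h \<le> psum y (Suc i)"
        using psum_mono[OF nx, of "Suc n" i] psum_mono[OF ny, of "Suc n" i]
          psum_mono[OF nx, of "Suc n" "Suc i"] psum_mono[OF ny, of "Suc n" "Suc i"] hx hy by linarith+
      then show ?thesis by (simp add: coord_fill nx ny del: psum_Suc)
    qed
  qed
  have "(\<lambda>i. min (coord x i) (coord y i)) sums (\<Sum>i\<in>{..n}. min (coord x i) (coord y i))"
    by (rule sums_finite) (use above in auto)
  also have "(\<Sum>i\<in>{..n}. min (coord x i) (coord y i)) = h"
    by (simp add: h_def psum_def below lessThan_Suc_atMost[symmetric])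
  finally have smin: "(\<lambda>i. min (coord x i) (coord y i)) sums h" .
  have sx: "coord x sums norm x" and sy: "coord y sums norm y"
    using summable_sums[OF summable_coord[of x]] summable_sums[OF summable_coord[of y]] nx ny
    by (simp_all add: norm_ell1_def)
  have "(\<lambda>i. (coord x i - min (coord x i) (coord y i)) + (coord y i - min (coord x i) (coord y i)))
      sums ((norm x - h) + (norm y - h))"
    by (intro sums_add sums_diff sx sy smin)
  also have "(\<lambda>i. (coord x i - min (coord x i) (coord y i)) + (coord y i - min (coord x i) (coord y i)))
      = (\<lambda>i. \<bar>coord (x - y) i\<bar>)" by (auto simp: min_def)
  finally have "dist x y = (norm x - h) + (norm y - h)"
    by (simp add: dist_norm norm_ell1_def[of "x - y"] sums_iff)
  moreover have "0 \<le> h" using h0 psum_mono[OF nx, of 0 n] by simp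
  moreover have "h \<le> norm x" "h \<le> norm y"
    using hx hy psum_le_norm[OF nx, of "Suc n"] psum_le_norm[OF ny, of "Suc n"] by linarith+
  ultimately show ?thesis using eq by (intro that) auto
qed

text \<open>
Descend from \<open>x\<close> to the branching point and climb to \<open>y\<close>.
\<close>

lemma geodesic_exists:
  assumes x: "x \<in> T" and y: "y \<in> T"
  obtains g where "1-lipschitz_on {0..dist x y} g" "g 0 = x" "g (dist x y) = y" "g ` {0..dist x y} \<subseteq> T"
proof -
  obtain h where h: "0 \<le> h" "h \<le> norm x" "h \<le> norm y" "fill x h = fill y h"
    "dist x y = (norm x - h) + (norm y - h)" by (rule branching_height[OF x y])
  note nx = coord_nonneg[OF x] and ny = coord_nonneg[OF y]
  define b where "b = norm x - h"
  define g where "g t = (if t \<le> b then fill x (norm x - t) else fill y (h + (t - b)))" for t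
  have "1-lipschitz_on {0..dist x y} g" unfolding g_def
  proof (rule lipschitz_on_concat)
    show "1-lipschitz_on {0..b} (\<lambda>t. fill x (norm x - t))"
    proof (rule lipschitz_onI)
      show "dist (fill x (norm x - s)) (fill x (norm x - t)) \<le> 1 * dist s t" for s t
        using lipschitz_onD[OF fill_lipschitz[OF nx, of UNIV], of "norm x - s" "norm x - t"]
        by (simp add: dist_real_def abs_minus_commute)
    qed simp
    show "1-lipschitz_on {b..dist x y} (\<lambda>t. fill y (h + (t - b)))"
    proof (rule lipschitz_onI)
      show "dist (fill y (h + (s - b))) (fill y (h + (t - b))) \<le> 1 * dist s t" for s t
        using lipschitz_onD[OF fill_lipschitz[OF ny, of UNIV], of "h + (s - b)" "h + (t - b)"]
        by (simp add: dist_real_def)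
    qed simp
    show "fill x (norm x - b) = fill y (h + (b - b))" using h by (simp add: b_def)
  qed
  moreover have "g 0 = x" using h by (simp add: g_def b_def fill_norm nx)
  moreover have "g (dist x y) = y"
    by (cases "norm y = h") (use h fill_norm[OF ny] in \<open>simp_all add: g_def b_def\<close>)
  moreover have "g ` {0..dist x y} \<subseteq> T"
    using h by (auto simp: g_def b_def intro!: fill_in_limit_tree x y)
  ultimately show ?thesis by (rule that)
qed

end

section \<open>The length metric is induced by the norm\<close>

lemma curve_length_ge_dist: "ennreal (dist (g 0) (g 1)) \<le> curve_length g"
proof -
  let ?t = "\<lambda>i :: nat. of_bool (i > 0) :: real"
  have "ennreal (\<Sum>i<1. dist (g (?t i)) (g (?t (Suc i)))) \<le> curve_length g"
    unfolding curve_length_def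
    by (rule SUP_upper2[of "(1, ?t)"]) (auto simp: mono_def)
  then show ?thesis by simp
qed

lemma curve_length_le_lipschitz:
  assumes "L-lipschitz_on {0..1} g"
  shows "curve_length g \<le> ennreal L"
  unfolding curve_length_def
proof (rule SUP_least, safe)
  fix n and t :: "nat \<Rightarrow> real" assume t: "mono t" "range t \<subseteq> {0..1}"
  have t01: "t i \<in> {0..1}" for i by (rule subsetD[OF t(2) rangeI])
  have "(\<Sum>i<n. dist (g (t i)) (g (t (Suc i)))) \<le> (\<Sum>i<n. L * (t (Suc i) - t i))"
  proof (rule sum_mono)
    fix i
    have "dist (t i) (t (Suc i)) = t (Suc i) - t i"
      using monoD[OF t(1), of i "Suc i"] by (simp add: dist_real_def)
    then show "dist (g (t i)) (g (t (Suc i))) \<le> L * (t (Suc i) - t i)"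
      using lipschitz_onD[OF assms t01[of i] t01[of "Suc i"]] by simp
  qed
  also have "\<dots> = L * (t n - t 0)" by (simp add: sum_lessThan_telescope flip: sum_distrib_left)
  also have "\<dots> \<le> L * 1"
    using t01[of n] t01[of 0] by (intro mult_left_mono lipschitz_on_nonneg[OF assms]) auto
  finally show "ennreal (\<Sum>i<n. dist (g (t i)) (g (t (Suc i)))) \<le> ennreal L" by (simp add: ennreal_leI)
qed

lemma length_dist_eq_dist:
  assumes g: "1-lipschitz_on {0..dist x y} g" "g 0 = x" "g (dist x y) = y" "g ` {0..dist x y} \<subseteq> S"
  shows "length_dist S x y = dist x y"
proof -
  define D where "D = dist x y"
  define k where "k t = g (D * t)" for t
  have D: "0 \<le> D" by (simp add: D_def)
  have in01: "D * t \<in> {0..D}" if "t \<in> {0..1}" for t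
    using that D mult_left_mono[of t 1 D] by auto
  have k: "D-lipschitz_on {0..1} k"
  proof (rule lipschitz_onI)
    fix s t :: real assume "s \<in> {0..1}" "t \<in> {0..1}"
    then have "dist (k s) (k t) \<le> 1 * dist (D * s) (D * t)"
      unfolding k_def using lipschitz_onD[OF g(1)] in01 by (simp add: D_def)
    also have "\<dots> = D * dist s t" using D by (simp add: dist_real_def abs_mult flip: right_diff_distrib)
    finally show "dist (k s) (k t) \<le> D * dist s t" .
  qed (rule D)
  have "(INF g \<in> {g. path g \<and> path_image g \<subseteq> S \<and> pathstart g = x \<and> pathfinish g = y}. curve_length g)
      = ennreal D"
  proof (rule antisym)
    have "path k" unfolding path_def by (rule lipschitz_on_continuous_on[OF k])
    moreover have "path_image k \<subseteq> S"
      using in01 g(4) by (force simp: path_image_def k_def D_def)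
    moreover have "pathstart k = x" "pathfinish k = y"
      using g by (simp_all add: pathstart_def pathfinish_def k_def D_def)
    ultimately show "(INF g \<in> {g. path g \<and> path_image g \<subseteq> S \<and> pathstart g = x \<and> pathfinish g = y}. curve_length g)
      \<le> ennreal D"
      using curve_length_le_lipschitz[OF k] by (auto intro: INF_lower2[of k])
    show "ennreal D \<le> (INF g \<in> {g. path g \<and> path_image g \<subseteq> S \<and> pathstart g = x \<and> pathfinish g = y}. curve_length g)"
    proof (rule INF_greatest)
      fix g assume "g \<in> {g. path g \<and> path_image g \<subseteq> S \<and> pathstart g = x \<and> pathfinish g = y}"
      then show "ennreal D \<le> curve_length g"
        using curve_length_ge_dist[of g] by (simp add: D_def pathstart_def pathfinish_def)
    qed
  qed
  then show ?thesis by (simp add: length_dist_def D_def)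
qed

text \<open>
No path in \<open>S\<close> reaches a point outside \<open>S\<close>. The infimum is then \<open>\<infinity>\<close>, which becomes \<open>0\<close> as a real
number.
\<close>

lemma length_dist_outside:
  assumes "x \<notin> S \<or> y \<notin> S"
  shows "length_dist S x y = 0"
proof -
  have "{g. path g \<and> path_image g \<subseteq> S \<and> pathstart g = x \<and> pathfinish g = y} = {}"
    using assms pathstart_in_path_image pathfinish_in_path_image by blast
  then show ?thesis unfolding length_dist_def by (simp only: image_empty Inf_empty top_ennreal_def[symmetric]) simp
qed

context growing_tree
begin

lemma length_dist_limit_tree:
  "length_dist T x y = (if x \<in> T \<and> y \<in> T then dist x y else 0)"
  using length_dist_outside[of x T y] geodesic_exists[of x y] length_dist_eq_dist[of x y _ T] by metis

end

text \<open>
The locale \<^locale>\<open>Metric_space\<close> demands that \<open>d\<close> be symmetric and nonnegative on the whole type;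
hence the hypothesis fixes its values outside \<open>S\<close> too.
\<close>

lemma mtopology_of_induced_metric:
  fixes S :: "'a::metric_space set"
  assumes "\<And>x y. d x y = (if x \<in> S \<and> y \<in> S then dist x y else 0)"
  shows "Metric_space.mtopology S d = subtopology euclidean S"
proof -
  interpret d: Metric_space S d
    by standard (auto simp: assms dist_commute dist_triangle)
  interpret e: Submetric UNIV dist S
    by standard auto
  have "d.mball x r = e.sub.mball x r" for x r
    by (auto simp: d.mball_def e.sub.mball_def assms)
  then have "d.mtopology = e.sub.mtopology"
    by (simp add: topology_eq d.openin_mtopology e.sub.openin_mtopology)
  then show ?thesis using e.mtopology_submetric by simp
qed

section \<open>Convergence of the trees\<close>

text \<open>
The counter \<open>nnz i x\<close> takes the values \<open>0, 1, 2, \<dots>\<close> in turn as \<open>i\<close> runs through the support.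
\<close>

lemma sum_over_support_eq_geometric:
  "(\<Sum>i<m. if coord x i \<noteq> 0 then q ^ nnz i x else 0) = (\<Sum>k<nnz m x. q ^ k :: real)"
  by (induction m) (auto simp: nnz_Suc)

lemma power_decay_bound:
  fixes a :: "nat \<Rightarrow> real"
  assumes pos: "\<And>i. i \<ge> 1 \<Longrightarrow> a i > 0"
    and ev: "\<forall>\<^sub>F i in sequentially. a i \<le> real i powr (- \<gamma>)"
  shows "\<exists>D>0. \<forall>i\<ge>1. a i \<le> D * real i powr (- \<gamma>)"
proof -
  obtain N where N: "\<And>i. i \<ge> N \<Longrightarrow> a i \<le> real i powr (- \<gamma>)"
    using ev by (auto simp: eventually_sequentially)
  define S where "S = (\<Sum>i\<in>{1..N}. a i * real i powr \<gamma>)"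
  have S: "0 \<le> S" unfolding S_def using pos by (intro sum_nonneg mult_nonneg_nonneg) (auto intro: less_imp_le)
  have "a i \<le> (1 + S) * real i powr (- \<gamma>)" if i: "i \<ge> 1" for i
  proof (cases "i \<le> N")
    case True
    have "a i * real i powr \<gamma> \<le> S" unfolding S_def
      using True i pos by (intro member_le_sum mult_nonneg_nonneg) (auto intro: less_imp_le)
    then have "a i * real i powr \<gamma> * real i powr (- \<gamma>) \<le> (1 + S) * real i powr (- \<gamma>)"
      by (intro mult_right_mono) auto
    then show ?thesis using i by (simp add: mult.assoc flip: powr_add)
  next
    case False
    then have "a i \<le> 1 * real i powr (- \<gamma>)" using N by simp
    also have "\<dots> \<le> (1 + S) * real i powr (- \<gamma>)" using S by (intro mult_right_mono) auto
    finally show ?thesis .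
  qed
  then show ?thesis using S by (intro exI[of _ "1 + S"]) auto
qed

lemma harm_le_ln: "n \<ge> 1 \<Longrightarrow> (harm n :: real) \<le> ln (real n) + 1"
proof -
  assume "n \<ge> 1"
  then obtain m where m: "n = Suc m" by (cases n) auto
  have "harm (Suc m) - ln (real (Suc m)) \<le> harm (Suc 0) - ln (real (Suc 0))"
    by (rule decseqD[OF decseq_harm_diff_ln]) simp
  also have "\<dots> = 1" by (simp only: harm_expand) simp
  finally show ?thesis by (simp add: m)
qed

context growing_tree
begin

lemma nnz_eq_nnz_glue: "x \<in> T \<Longrightarrow> coord x i \<noteq> 0 \<Longrightarrow> nnz i x = nnz i (glue_point u i)"
  using trunc_eq_glue_point[of x i] nnz_trunc[of i x] by simp

text \<open>
If coordinate \<open>i\<close> of \<open>x\<close> is nonzero and \<open>k = nnz i x\<close>, then \<open>k\<close> is the generation of the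
gluing point \<open>u i\<close>, so that \<open>2\<^bsup>k\<^esup> \<le> C i\<^sup>3\<close> and \<open>i\<^bsup>-3\<delta>\<^esup> \<le> C\<^bsup>\<delta>\<^esup> 2\<^bsup>-\<delta>k\<^esup>\<close>. With
\<open>3\<delta> = \<gamma> - \<beta>\<close> this trades part of the decay of the branch lengths for a geometric series in \<open>k\<close>.
\<close>

lemma uniform_tail_bound:
  assumes C: "\<And>m. m \<ge> 1 \<Longrightarrow> 2 ^ nnz m (u m) \<le> C * real m ^ 3"
    and D: "0 < D" "\<And>i. i \<ge> 1 \<Longrightarrow> a i \<le> D * real i powr (- \<gamma>)"
    and \<beta>: "0 < \<beta>" "\<beta> < \<gamma>"
  obtains K where "0 \<le> K" "\<And>x n. x \<in> T \<Longrightarrow> n \<ge> 1 \<Longrightarrow> dist x (trunc n x) \<le> K * real n powr (- \<beta>)"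
proof -
  define \<delta> where "\<delta> = (\<gamma> - \<beta>) / 3"
  define q :: real where "q = 2 powr (- \<delta>)"
  have \<delta>: "0 < \<delta>" using \<beta> by (simp add: \<delta>_def)
  have q: "0 < q" "q < 1" using \<delta> powr_less_mono[of "- \<delta>" 0 2] by (simp_all add: q_def)
  have C0: "0 < C" using C[of 1] less_le_trans[of 0 "2 ^ nnz 1 (u 1)" C] by simp
  define B where "B = D * C powr \<delta>"
  have B: "0 \<le> B" using D by (simp add: B_def)
  \<comment> \<open>The decay \<open>i powr (- \<gamma>)\<close> is split into \<open>i powr (- \<beta>)\<close> and the factor \<open>(i ^ 3) powr (- \<delta>)\<close>.\<close>
  have single: "coord x i \<le> B * real n powr (- \<beta>) * q ^ nnz i x"
    if x: "x \<in> T" and i: "coord x i \<noteq> 0" "n \<le> i" "n \<ge> 1" for x i n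
  proof -
    have "2 ^ nnz i x \<le> C * real i ^ 3"
      using C[of i] nnz_eq_nnz_glue[OF x i(1)] i by (simp add: glue_point_def)
    then have "(real i ^ 3) powr (- \<delta>) \<le> (2 ^ nnz i x / C) powr (- \<delta>)"
      using C0 \<delta> by (intro powr_mono2') (auto simp: field_simps)
    also have "\<dots> = C powr \<delta> * q ^ nnz i x"
    proof -
      have "(2 ^ nnz i x) powr (- \<delta>) = q ^ nnz i x"
        by (simp add: q_def powr_powr powr_realpow[symmetric] mult.commute)
      then show ?thesis using C0 by (simp add: powr_divide powr_minus field_simps)
    qed
    finally have *: "(real i ^ 3) powr (- \<delta>) \<le> C powr \<delta> * q ^ nnz i x" .
    have "coord x i \<le> a (Suc i)" by (rule coord_le_length[OF x])
    also have "\<dots> \<le> D * real (Suc i) powr (- \<gamma>)" by (rule D) simp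
    also have "\<dots> \<le> D * real i powr (- \<gamma>)"
      using D \<beta> i by (intro mult_left_mono powr_mono2') auto
    also have "real i powr (- \<gamma>) = real i powr (- \<beta>) * (real i ^ 3) powr (- \<delta>)"
    proof -
      have "(real i ^ 3) powr (- \<delta>) = (real i powr 3) powr (- \<delta>)" using i by simp
      also have "\<dots> = real i powr (- (3 * \<delta>))" by (simp only: powr_powr) simp
      finally have "real i powr (- \<beta>) * (real i ^ 3) powr (- \<delta>) = real i powr (- \<beta> + - (3 * \<delta>))"
        by (simp only: powr_add)
      also have "- \<beta> + - (3 * \<delta>) = - \<gamma>" by (simp add: \<delta>_def field_simps)
      finally show ?thesis by (rule sym)
    qed
    also have "D * \<dots> \<le> D * (real n powr (- \<beta>) * (C powr \<delta> * q ^ nnz i x))"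
      using D \<beta> i * by (intro mult_left_mono mult_mono powr_mono2') auto
    finally show ?thesis by (simp add: B_def mult_ac)
  qed
  have "dist x (trunc n x) \<le> B / (1 - q) * real n powr (- \<beta>)" if x: "x \<in> T" and n: "n \<ge> 1" for x n
    unfolding dist_norm
  proof (rule norm_le_of_partial_sums)
    fix m
    have "(\<Sum>i<m. \<bar>coord (x - trunc n x) i\<bar>)
        \<le> (\<Sum>i<m. B * real n powr (- \<beta>) * (if coord x i \<noteq> 0 then q ^ nnz i x else 0))"
    proof (rule sum_mono)
      fix i
      show "\<bar>coord (x - trunc n x) i\<bar> \<le> B * real n powr (- \<beta>) * (if coord x i \<noteq> 0 then q ^ nnz i x else 0)"
        using single[OF x, of i n] n B q coord_nonneg[OF x, of i] by (auto simp: not_less)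
    qed
    also have "\<dots> = B * real n powr (- \<beta>) * (\<Sum>k<nnz m x. q ^ k)"
      unfolding sum_over_support_eq_geometric[symmetric] by (rule sum_distrib_left[symmetric])
    also have "\<dots> \<le> B * real n powr (- \<beta>) * (1 / (1 - q))"
    proof (rule mult_left_mono)
      have "(\<Sum>k<nnz m x. q ^ k) \<le> (\<Sum>k. q ^ k)"
        using q by (intro sum_le_suminf summable_geometric) auto
      then show "(\<Sum>k<nnz m x. q ^ k) \<le> 1 / (1 - q)" using q by (simp add: suminf_geometric)
    qed (use B in simp)
    finally show "(\<Sum>i<m. \<bar>coord (x - trunc n x) i\<bar>) \<le> B / (1 - q) * real n powr (- \<beta>)"
      by simp
  qed
  then show ?thesis using B q by (intro that[of "B / (1 - q)"]) auto
qed

section \<open>Covering the limit tree\<close>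

lemma agg_tree_cases:
  assumes "y \<in> agg_tree a u n" "n \<ge> 1"
  obtains i s where "i < n" "0 \<le> s" "s \<le> a (Suc i)" "y = branch_point u i s"
proof -
  have "agg_tree a u n = (\<Union>i<n. branch_point u i ` {0..a (Suc i)})"
    using assms(2)
  proof (induction n rule: nat_induct_at_least)
    case base
    have "(0 :: ell1) = branch_point u 0 0" "(0 :: real) \<in> {0..a (Suc 0)}"
      using length_pos[of "Suc 0"] by (simp_all add: branch_point_def glue_point_def)
    then have "0 \<in> branch_point u 0 ` {0..a (Suc 0)}" by (rule image_eqI)
    then show ?case by (simp add: lessThan_Suc insert_absorb)
  next
    case (Suc n)
    then show ?case by (simp add: lessThan_Suc Un_commute)
  qed
  with assms(1) obtain i where "i < n" "y \<in> branch_point u i ` {0..a (Suc i)}" by blast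
  then show ?thesis using that[of i] by fastforce
qed

lemma agg_tree_cover:
  assumes n: "n \<ge> 1" and r: "0 < r"
  obtains P where "finite P" "real (card P) \<le> (\<Sum>i<n. a (Suc i) / r + 1)"
    "\<And>y. y \<in> agg_tree a u n \<Longrightarrow> \<exists>p\<in>P. dist p y \<le> r"
proof -
  define k where "k i = nat \<lfloor>a (Suc i) / r\<rfloor>" for i
  define P where "P = (\<Union>i<n. (\<lambda>j. branch_point u i (real j * r)) ` {..k i})"
  have "finite P" by (simp add: P_def)
  moreover have "real (card P) \<le> (\<Sum>i<n. a (Suc i) / r + 1)"
  proof -
    have "card P \<le> (\<Sum>i<n. card ((\<lambda>j. branch_point u i (real j * r)) ` {..k i}))"
      unfolding P_def by (rule card_UN_le) simp
    also have "\<dots> \<le> (\<Sum>i<n. k i + 1)"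
      by (intro sum_mono order_trans[OF card_image_le]) auto
    finally have "real (card P) \<le> real (\<Sum>i<n. k i + 1)" by (rule of_nat_mono)
    also have "\<dots> = (\<Sum>i<n. real (k i) + 1)" by (simp add: add.commute)
    also have "\<dots> \<le> (\<Sum>i<n. a (Suc i) / r + 1)"
    proof (intro sum_mono add_right_mono)
      fix i
      have "0 \<le> a (Suc i) / r" using r length_pos[of "Suc i"] by simp
      then show "real (k i) \<le> a (Suc i) / r" unfolding k_def by (rule of_nat_floor)
    qed
    finally show ?thesis .
  qed
  moreover have "\<exists>p\<in>P. dist p y \<le> r" if y: "y \<in> agg_tree a u n" for y
  proof -
    obtain i s where i: "i < n" "0 \<le> s" "s \<le> a (Suc i)" "y = branch_point u i s"
      using agg_tree_cases[OF y n] .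
    define j where "j = nat \<lfloor>s / r\<rfloor>"
    have "real j \<le> s / r" "s / r < real j + 1" using i r by (simp_all add: j_def)
    then have "real j * r \<le> s" "s \<le> real j * r + r" using r by (simp_all add: field_simps)
    then have "dist (branch_point u i (real j * r)) y \<le> r"
      by (simp add: i dist_branch_point)
    moreover have "j \<le> k i" unfolding j_def k_def
      using i r by (intro nat_mono floor_mono divide_right_mono) auto
    ultimately show ?thesis using i by (auto simp: P_def)
  qed
  ultimately show ?thesis by (rule that)
qed

text \<open>
Branch \<open>i + 1\<close> needs at most \<open>D (n / (i + 1))\<^bsup>\<beta>\<^esup> + 1\<close> centres. Since \<open>\<beta> \<le> 1\<close> and \<open>i < n\<close> the power is at
most \<open>n / (i + 1)\<close>, and the sum over the branches is a harmonic one.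
\<close>

lemma limit_tree_cover:
  assumes C: "\<And>m. m \<ge> 1 \<Longrightarrow> 2 ^ nnz m (u m) \<le> C * real m ^ 3"
    and D: "0 < D" "\<And>i. i \<ge> 1 \<Longrightarrow> a i \<le> D * real i powr (- \<gamma>)"
    and \<beta>: "0 < \<beta>" "\<beta> < \<gamma>" "\<beta> \<le> 1"
  obtains K where "0 < K" "\<And>n. n \<ge> 1 \<Longrightarrow> \<exists>P. finite P \<and>
    real (card P) \<le> real n * (D * (ln (real n) + 1) + 1) \<and> T \<subseteq> (\<Union>p\<in>P. cball p (K * real n powr (- \<beta>)))"
proof -
  obtain K where K: "0 \<le> K" "\<And>x n. x \<in> T \<Longrightarrow> n \<ge> 1 \<Longrightarrow> dist x (trunc n x) \<le> K * real n powr (- \<beta>)"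
    using uniform_tail_bound[OF C D \<beta>(1,2)] by metis
  have "\<exists>P. finite P \<and> real (card P) \<le> real n * (D * (ln (real n) + 1) + 1) \<and>
    T \<subseteq> (\<Union>p\<in>P. cball p ((K + 1) * real n powr (- \<beta>)))" if n: "n \<ge> 1" for n
  proof -
    let ?r = "real n powr (- \<beta>)"
    have r: "0 < ?r" using n by simp
    obtain P where P: "finite P" "real (card P) \<le> (\<Sum>i<n. a (Suc i) / ?r + 1)"
      "\<And>y. y \<in> agg_tree a u n \<Longrightarrow> \<exists>p\<in>P. dist p y \<le> ?r" using agg_tree_cover[OF n r] by metis
    have "(\<Sum>i<n. a (Suc i) / ?r + 1) \<le> (\<Sum>i<n. D * real n * inverse (real (Suc i)) + 1)"
    proof (intro sum_mono add_right_mono)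
      fix i assume "i \<in> {..<n}"
      then have i: "real (Suc i) \<le> real n" by simp
      have "a (Suc i) \<le> D * real (Suc i) powr (- \<gamma>)" by (rule D) simp
      also have "\<dots> \<le> D * real (Suc i) powr (- \<beta>)"
        using D \<beta> by (intro mult_left_mono powr_mono) auto
      finally have "a (Suc i) / ?r \<le> D * real (Suc i) powr (- \<beta>) / ?r"
        by (rule divide_right_mono) simp
      also have "\<dots> = D * (real n / real (Suc i)) powr \<beta>"
        using n by (simp add: powr_divide powr_minus field_simps)
      also have "\<dots> \<le> D * (real n / real (Suc i)) powr 1"
        using D \<beta> i by (intro mult_left_mono powr_mono) (auto simp: field_simps)
      finally show "a (Suc i) / ?r \<le> D * real n * inverse (real (Suc i))"
        using n by (simp add: divide_inverse mult.assoc)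
    qed
    also have "\<dots> = D * real n * harm n + real n"
      by (simp add: harm_altdef sum.distrib sum_distrib_left)
    also have "\<dots> \<le> D * real n * (ln (real n) + 1) + real n"
      using D harm_le_ln[OF n] by (intro add_right_mono mult_left_mono) auto
    finally have "real (card P) \<le> real n * (D * (ln (real n) + 1) + 1)"
      using P(2) by (simp add: algebra_simps)
    moreover have "T \<subseteq> (\<Union>p\<in>P. cball p ((K + 1) * ?r))"
    proof
      fix x assume x: "x \<in> T"
      obtain p where p: "p \<in> P" "dist p (trunc n x) \<le> ?r" using P(3)[OF trunc_limit_tree[OF x]] by auto
      have "dist p x \<le> dist p (trunc n x) + dist x (trunc n x)" by (rule dist_triangle2)
      also have "\<dots> \<le> (K + 1) * ?r" using p(2) K(2)[OF x n] by (simp add: algebra_simps)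
      finally show "x \<in> (\<Union>p\<in>P. cball p ((K + 1) * ?r))" using p(1) by auto
    qed
    ultimately show ?thesis using P(1) by blast
  qed
  then show ?thesis using K(1) by (intro that[of "K + 1"]) auto
qed

end

section \<open>Compactness and Hausdorff dimension\<close>

lemma hausdorff_premeasure_le_cover:
  assumes d: "\<And>x y. x \<in> S \<Longrightarrow> y \<in> S \<Longrightarrow> d x y = dist x y"
    and P: "finite P" "S \<subseteq> (\<Union>p\<in>P. cball p r)" and r: "0 \<le> r" "2 * r \<le> \<delta>" and s: "0 < s"
  shows "hausdorff_premeasure S d s \<delta> \<le> ennreal (real (card P) * (2 * r) powr s)"
proof -
  obtain ps where ps: "set ps = P" "distinct ps" using finite_distinct_list[OF P(1)] by auto
  have len: "length ps = card P" using ps distinct_card by fastforce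
  define C where "C i = (if i < length ps then S \<inter> cball (ps ! i) r else {})" for i
  have diam: "mdiam d (C i) \<le> ennreal (2 * r)" for i
    unfolding mdiam_def
  proof (intro SUP_least)
    fix x y assume "x \<in> C i" "y \<in> C i"
    then have "x \<in> S" "y \<in> S" "dist (ps ! i) x \<le> r" "dist (ps ! i) y \<le> r"
      by (auto simp: C_def split: if_splits)
    then have "d x y \<le> 2 * r" using d[of x y] dist_triangle3[of x y "ps ! i"] by simp
    then show "ennreal (d x y) \<le> ennreal (2 * r)" by (rule ennreal_leI)
  qed
  have diam_powr: "diam_powr d s (C i) \<le> ennreal ((2 * r) powr s)" for i
  proof -
    have "enn2real (mdiam d (C i)) powr s \<le> (2 * r) powr s"
      using enn2real_mono[OF diam[of i]] s r by (intro powr_mono2) auto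
    then show ?thesis using s by (simp add: diam_powr_def ennreal_leI)
  qed
  have "hausdorff_premeasure S d s \<delta> \<le> (\<Sum>i. diam_powr d s (C i))"
    unfolding hausdorff_premeasure_def
  proof (intro INF_lower CollectI conjI allI subsetI)
    fix x assume x: "x \<in> S"
    then obtain p where p: "p \<in> set ps" "x \<in> cball p r" using P(2) ps(1) by blast
    then obtain i where "i < length ps" "p = ps ! i" by (metis in_set_conv_nth)
    then have "x \<in> C i" using x p by (simp add: C_def)
    then show "x \<in> (\<Union>i. C i)" by blast
  next
    show "mdiam d (C i) \<le> ennreal \<delta>" for i
      using diam[of i] ennreal_leI[OF r(2)] by (rule order_trans)
  qed (auto simp: C_def split: if_splits)
  also have "\<dots> = (\<Sum>i<length ps. diam_powr d s (C i))"
    by (rule suminf_finite) (auto simp: C_def diam_powr_def)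
  also have "\<dots> \<le> (\<Sum>i<length ps. ennreal ((2 * r) powr s))"
    by (rule sum_mono) (rule diam_powr)
  also have "\<dots> = ennreal (real (card P) * (2 * r) powr s)"
    by (simp add: len ennreal_mult ennreal_of_nat_eq_real_of_nat)
  finally show ?thesis .
qed

lemma hausdorff_dim_le:
  assumes "\<And>s. b < s \<Longrightarrow> hausdorff_measure S d s = 0" "0 \<le> b"
  shows "hausdorff_dim S d \<le> ennreal b"
proof (rule ennreal_le_epsilon)
  fix e :: real assume "0 < e"
  then have "hausdorff_dim S d \<le> ennreal (b + e)" unfolding hausdorff_dim_def
    using assms(2) assms(1)[of "b + e"] by (intro INF_lower) auto
  also have "\<dots> = ennreal b + ennreal e" using \<open>0 < e\<close> assms(2) by simp
  finally show "hausdorff_dim S d \<le> ennreal b + ennreal e" .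
qed

context growing_tree
begin

lemma compact_limit_tree:
  assumes C: "\<And>m. m \<ge> 1 \<Longrightarrow> 2 ^ nnz m (u m) \<le> C * real m ^ 3"
    and \<alpha>: "0 < \<alpha>" "\<alpha> \<le> 1"
    and decay: "\<forall>\<epsilon>>0. \<forall>\<^sub>F i in sequentially. a i \<le> real i powr (- \<alpha> + \<epsilon>)"
  shows "compact T"
proof -
  have "\<forall>\<^sub>F i in sequentially. a i \<le> real i powr (- (\<alpha> / 2))"
    using decay[rule_format, of "\<alpha> / 2"] \<alpha> by simp
  then obtain D where D: "0 < D" "\<And>i. i \<ge> 1 \<Longrightarrow> a i \<le> D * real i powr (- (\<alpha> / 2))"
    using power_decay_bound[of a, OF length_pos] by blast
  obtain K where K: "0 < K" "\<And>n. n \<ge> 1 \<Longrightarrow> \<exists>P. finite P \<and>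
    real (card P) \<le> real n * (D * (ln (real n) + 1) + 1) \<and> T \<subseteq> (\<Union>p\<in>P. cball p (K * real n powr (- (\<alpha> / 4))))"
    using limit_tree_cover[OF C D, of "\<alpha> / 4"] \<alpha> by auto
  have "\<exists>P. finite P \<and> T \<subseteq> (\<Union>p\<in>P. ball p e)" if e: "0 < e" for e
  proof -
    have "(\<lambda>n. K * real n powr (- (\<alpha> / 4))) \<longlonglongrightarrow> 0" using \<alpha> by real_asymp
    then have "\<forall>\<^sub>F n in sequentially. K * real n powr (- (\<alpha> / 4)) < e" using e by (rule order_tendstoD)
    then obtain n where n: "n \<ge> 1" "K * real n powr (- (\<alpha> / 4)) < e"
      using eventually_happens'[OF _ eventually_conj[OF eventually_ge_at_top[of 1]]] sequentially_bot by blast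
    obtain P where P: "finite P" "T \<subseteq> (\<Union>p\<in>P. cball p (K * real n powr (- (\<alpha> / 4))))" using K(2)[OF n(1)] by auto
    have "cball p (K * real n powr (- (\<alpha> / 4))) \<subseteq> ball p e" for p using n(2) by auto
    then have "T \<subseteq> (\<Union>p\<in>P. ball p e)" using P(2) by blast
    then show ?thesis using P(1) by blast
  qed
  moreover have "closed T" by (simp add: limit_tree_def)
  ultimately show ?thesis by (simp add: compact_eq_totally_bounded complete_eq_closed)
qed

text \<open>
For \<open>s > 1 / \<alpha>\<close> choose \<open>1 / s < \<beta> < \<gamma> < \<alpha>\<close>. The covers by \<open>O(n log n)\<close> balls of radius \<open>O(n\<^bsup>-\<beta>\<^esup>)\<close>
have total cost \<open>O(n\<^bsup>1 - \<beta>s\<^esup> log n)\<close>, which tends to \<open>0\<close>.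
\<close>

lemma hausdorff_dim_limit_tree_le:
  assumes C: "\<And>m. m \<ge> 1 \<Longrightarrow> 2 ^ nnz m (u m) \<le> C * real m ^ 3"
    and \<alpha>: "0 < \<alpha>" "\<alpha> \<le> 1"
    and decay: "\<forall>\<epsilon>>0. \<forall>\<^sub>F i in sequentially. a i \<le> real i powr (- \<alpha> + \<epsilon>)"
    and d: "\<And>x y. x \<in> T \<Longrightarrow> y \<in> T \<Longrightarrow> d x y = dist x y"
  shows "hausdorff_dim T d \<le> ennreal (1 / \<alpha>)"
proof (rule hausdorff_dim_le)
  fix s assume s: "1 / \<alpha> < s"
  then have s0: "0 < s" using \<alpha> by (simp add: less_trans[of 0 "1 / \<alpha>"])
  have "1 / s < \<alpha>" using s s0 \<alpha> by (simp add: field_simps)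
  then obtain \<beta> where \<beta>: "1 / s < \<beta>" "\<beta> < \<alpha>" using dense by blast
  obtain \<gamma> where \<gamma>: "\<beta> < \<gamma>" "\<gamma> < \<alpha>" using dense \<beta>(2) by blast
  have \<beta>0: "0 < \<beta>" using \<beta> s0 less_trans[of 0 "1 / s"] by simp
  have "\<forall>\<^sub>F i in sequentially. a i \<le> real i powr (- \<gamma>)"
    using decay[rule_format, of "\<alpha> - \<gamma>"] \<gamma> by simp
  then obtain D where D: "0 < D" "\<And>i. i \<ge> 1 \<Longrightarrow> a i \<le> D * real i powr (- \<gamma>)"
    using power_decay_bound[of a, OF length_pos] by blast
  obtain K where K: "0 < K" "\<And>n. n \<ge> 1 \<Longrightarrow> \<exists>P. finite P \<and>
    real (card P) \<le> real n * (D * (ln (real n) + 1) + 1) \<and> T \<subseteq> (\<Union>p\<in>P. cball p (K * real n powr (- \<beta>)))"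
    using limit_tree_cover[OF C D \<beta>0 \<gamma>(1)] \<beta> \<alpha> by auto
  define e where "e = \<beta> * s - 1"
  have e: "0 < e" using \<beta>(1) s0 by (simp add: e_def field_simps)
  define f where "f n = (2 * K) powr s * ((D * (ln (real n) + 1) + 1) * real n powr (- e))" for n
  have f: "f \<longlonglongrightarrow> 0"
  proof -
    have "(\<lambda>n. ln (real n) * real n powr (- e)) \<longlonglongrightarrow> 0" "(\<lambda>n. real n powr (- e)) \<longlonglongrightarrow> 0"
      using e by real_asymp+
    then have "(\<lambda>n. (2 * K) powr s * (D * (ln (real n) * real n powr (- e)) + (D + 1) * real n powr (- e)))
        \<longlonglongrightarrow> (2 * K) powr s * (D * 0 + (D + 1) * 0)"
      by (intro tendsto_intros)
    moreover have "(\<lambda>n. (2 * K) powr s * (D * (ln (real n) * real n powr (- e)) + (D + 1) * real n powr (- e))) = f"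
      by (simp add: f_def fun_eq_iff algebra_simps)
    ultimately show ?thesis by simp
  qed
  have "hausdorff_premeasure T d s \<delta> = 0" if \<delta>: "0 < \<delta>" for \<delta>
  proof -
    have "(\<lambda>n. 2 * (K * real n powr (- \<beta>))) \<longlonglongrightarrow> 0" using \<beta>0 by real_asymp
    then have "\<forall>\<^sub>F n in sequentially. 2 * (K * real n powr (- \<beta>)) < \<delta>" using \<delta> by (rule order_tendstoD)
    then have "\<forall>\<^sub>F n in sequentially. hausdorff_premeasure T d s \<delta> \<le> ennreal (f n)"
      using eventually_ge_at_top[of 1]
    proof eventually_elim
      case (elim n)
      obtain P where P: "finite P" "real (card P) \<le> real n * (D * (ln (real n) + 1) + 1)"
        "T \<subseteq> (\<Union>p\<in>P. cball p (K * real n powr (- \<beta>)))" using K(2)[OF elim(2)] by auto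
      have "hausdorff_premeasure T d s \<delta> \<le> ennreal (real (card P) * (2 * (K * real n powr (- \<beta>))) powr s)"
        using elim K(1) s0 by (intro hausdorff_premeasure_le_cover d P(1,3)) auto
      also have "\<dots> \<le> ennreal (real n * (D * (ln (real n) + 1) + 1) * (2 * (K * real n powr (- \<beta>))) powr s)"
        by (intro ennreal_leI mult_right_mono P(2)) simp
      also have "(2 * (K * real n powr (- \<beta>))) powr s = (2 * K) powr s * real n powr (- (\<beta> * s))"
        using K(1) powr_mult[of "2 * K" "real n powr (- \<beta>)" s] by (simp add: powr_powr mult.assoc)
      also have "real n powr (- (\<beta> * s)) = real n powr (- 1) * real n powr (- e)"
        unfolding powr_add[symmetric] by (simp add: e_def)
      also have "real n * (D * (ln (real n) + 1) + 1) * ((2 * K) powr s * (real n powr (- 1) * real n powr (- e))) = f n"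
        using elim by (simp add: f_def powr_minus field_simps)
      finally show ?case .
    qed
    moreover have "(\<lambda>n. ennreal (f n)) \<longlonglongrightarrow> 0" using tendsto_ennrealI[OF f] by simp
    ultimately have "hausdorff_premeasure T d s \<delta> \<le> 0"
      by (intro tendsto_lowerbound[of "\<lambda>n. ennreal (f n)"]) auto
    then show ?thesis by simp
  qed
  then show "hausdorff_measure T d s = 0" by (simp add: hausdorff_measure_def)
qed (use \<alpha> in simp)

end

section \<open>The uniform measure on a tree\<close>

text \<open>
Intersecting with the tree in the definition of the uniform measure changes nothing, because each
branch is contained in the tree.
\<close>

lemma measure_uniform_on_tree:
  assumes pos: "\<And>i. i \<ge> 1 \<Longrightarrow> a i > 0" and n: "n \<ge> 1" and B: "B \<in> sets borel"
  shows "measure (uniform_on_tree a u n) B =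
    (\<Sum>i<n. measure lborel ({0..a (Suc i)} \<inter> branch_point u i -` B)) / (\<Sum>i<n. a (Suc i))"
proof -
  let ?L = "length_measure a u n" and ?T = "agg_tree a u n"
  have emeasure_L: "emeasure ?L A = ennreal (\<Sum>i<n. measure lborel ({0..a (Suc i)} \<inter> branch_point u i -` A))"
    if A: "A \<in> sets borel" for A
  proof -
    have "emeasure lborel ({0..a (Suc i)} \<inter> branch_point u i -` A)
        = ennreal (measure lborel ({0..a (Suc i)} \<inter> branch_point u i -` A))" for i
    proof (rule emeasure_eq_ennreal_measure)
      have "emeasure lborel ({0..a (Suc i)} \<inter> branch_point u i -` A) \<le> emeasure lborel {0..a (Suc i)}"
        by (rule emeasure_mono) auto
      also have "\<dots> < top" using pos[of "Suc i"] by simp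
      finally show "emeasure lborel ({0..a (Suc i)} \<inter> branch_point u i -` A) \<noteq> top" by simp
    qed
    then show ?thesis by (simp add: emeasure_length_measure[OF A] sum_ennreal)
  qed
  have T: "?T \<in> sets borel" by (rule borel_compact[OF compact_agg_tree])
  have whole: "{0..a (Suc i)} \<inter> branch_point u i -` (?T \<inter> A) = {0..a (Suc i)} \<inter> branch_point u i -` A"
    if "i < n" for i A
    using branch_subset_agg_tree[OF that, of u a] by auto
  have eT: "emeasure ?L ?T = ennreal (\<Sum>i<n. a (Suc i))"
    using emeasure_L[OF T] whole[of _ UNIV] less_imp_le[OF pos[of "Suc i" for i]] by simp
  have "a 1 \<le> (\<Sum>i<n. a (Suc i))"
    using member_le_sum[of 0 "{..<n}" "\<lambda>i. a (Suc i)"] n less_imp_le[OF pos[of "Suc i" for i]] by simp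
  then have A: "0 < (\<Sum>i<n. a (Suc i))" using pos[of 1] by simp
  have "emeasure ?L (?T \<inter> B) = ennreal (\<Sum>i<n. measure lborel ({0..a (Suc i)} \<inter> branch_point u i -` B))"
    using emeasure_L[of "?T \<inter> B"] T B whole by simp
  then have "measure ?L (?T \<inter> B) = (\<Sum>i<n. measure lborel ({0..a (Suc i)} \<inter> branch_point u i -` B))"
    by (simp add: measure_def sum_nonneg)
  moreover have "measure ?L ?T = (\<Sum>i<n. a (Suc i))" using A by (simp add: measure_def eT)
  moreover have "emeasure ?L ?T \<noteq> 0" "emeasure ?L ?T \<noteq> \<infinity>" using A by (simp_all add: eT)
  ultimately show ?thesis using B unfolding uniform_on_tree_def by simp
qed

text \<open>
A gluing point belongs both to its new branch and to the older tree, so a generation is constant only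
on the half-open part of a branch. The endpoint is a null set.
\<close>

lemma measure_lborel_between_intervals:
  fixes b :: real
  assumes S: "S \<subseteq> {0..b}" and b: "0 < b" and P: "\<And>s. 0 < s \<Longrightarrow> s \<le> b \<Longrightarrow> s \<in> S \<longleftrightarrow> P"
  shows "measure lborel S = b * of_bool P"
proof (cases P)
  case True
  have "S = {0<..b} \<or> S = {0..b}"
  proof (cases "0 \<in> S")
    case 0: True
    have "x \<in> S" if "0 \<le> x" "x \<le> b" for x
      using that 0 P[of x] True by (cases "x = 0") auto
    then show ?thesis using S by auto
  next
    case 0: False
    have "x \<in> S \<longleftrightarrow> x \<in> {0<..b}" for x
      using 0 S P[of x] True by (cases "x = 0") (auto simp: subset_iff)
    then show ?thesis by blast
  qed
  then show ?thesis using True b by auto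
next
  case False
  have "x = 0" if "x \<in> S" for x
    using that S P[of x] False by (cases "x = 0") auto
  then have "S = {} \<or> S = {0}" by auto
  then show ?thesis using False by auto
qed

context growing_tree
begin

lemma nnz_branch_point:
  assumes "i < n" "0 < s"
  shows "nnz n (branch_point u i s) = nnz i (glue_point u i) + 1"
proof -
  have "nnz n (branch_point u i s) = nnz (Suc i) (branch_point u i s)"
    using assms by (intro nnz_eq_of_coord_zero) (auto simp: coord_branch_point coord_glue_point_eq_0)
  also have "\<dots> = nnz i (branch_point u i s) + 1"
    using assms by (simp add: nnz_Suc coord_branch_point coord_glue_point_eq_0)
  also have "nnz i (branch_point u i s) = nnz i (glue_point u i)"
    by (simp add: nnz_def coord_branch_point)
  finally show ?thesis .
qed

text \<open>
The generation is one more than that of the gluing point on the whole of a branch, except at the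
gluing point itself.
\<close>

lemma measure_uniform_on_tree_nnz:
  assumes n: "n \<ge> 1"
  shows "measure (uniform_on_tree a u n) {x. nnz n x = k} =
    (\<Sum>i<n. a (Suc i) * of_bool (nnz i (glue_point u i) + 1 = k)) / (\<Sum>i<n. a (Suc i))"
proof -
  have "measure lborel ({0..a (Suc i)} \<inter> branch_point u i -` {x. nnz n x = k})
      = a (Suc i) * of_bool (nnz i (glue_point u i) + 1 = k)" (is "measure lborel ?S = _") if i: "i < n" for i
  proof (rule measure_lborel_between_intervals)
    show "0 < a (Suc i)" by (rule length_pos) simp
    show "s \<in> ?S \<longleftrightarrow> nnz i (glue_point u i) + 1 = k" if "0 < s" "s \<le> a (Suc i)" for s
      using that nnz_branch_point[OF i] by simp
  qed simp
  moreover have "{x. nnz n x = k} \<in> sets borel" by measurable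
  ultimately show ?thesis using measure_uniform_on_tree[OF length_pos n] by simp
qed

end

lemma (in prob_space) expectation_sum_indicator:
  fixes c :: "'i \<Rightarrow> real"
  assumes "\<And>i. i \<in> I \<Longrightarrow> A i \<in> events"
  shows "expectation (\<lambda>\<omega>. \<Sum>i\<in>I. c i * indicator (A i) \<omega>) = (\<Sum>i\<in>I. c i * prob (A i))"
proof -
  have "integrable M (\<lambda>\<omega>. c i * indicator (A i) \<omega>)" if "i \<in> I" for i
    using assms[OF that] by (intro integrable_mult_right integrable_real_indicator) (simp_all add: less_top[symmetric])
  then have "expectation (\<lambda>\<omega>. \<Sum>i\<in>I. c i * indicator (A i) \<omega>) = (\<Sum>i\<in>I. expectation (\<lambda>\<omega>. c i * indicator (A i) \<omega>))"
    by (rule Bochner_Integration.integral_sum)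
  also have "\<dots> = (\<Sum>i\<in>I. c i * prob (A i))"
    using assms sets.sets_into_space by (intro sum.cong) (auto simp: Int_absorb2)
  finally show ?thesis .
qed

lemma (in prob_space) expectation_power_bounded:
  fixes X :: "'a \<Rightarrow> nat"
  assumes [measurable]: "X \<in> measurable M (count_space UNIV)" and X: "\<And>\<omega>. X \<omega> \<le> n"
  shows "expectation (\<lambda>\<omega>. 2 ^ X \<omega>) = (\<Sum>k\<le>n. 2 ^ k * prob {\<omega> \<in> space M. X \<omega> = k})"
proof -
  have "expectation (\<lambda>\<omega>. 2 ^ X \<omega> :: real) = expectation (\<lambda>\<omega>. \<Sum>k\<le>n. 2 ^ k * indicator {\<omega> \<in> space M. X \<omega> = k} \<omega>)"
  proof (rule Bochner_Integration.integral_cong)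
    fix \<omega> assume "\<omega> \<in> space M"
    then have "(\<Sum>k\<le>n. 2 ^ k * indicator {\<omega> \<in> space M. X \<omega> = k} \<omega>) = (\<Sum>k\<le>n. if X \<omega> = k then 2 ^ k else 0 :: real)"
      by (intro sum.cong) auto
    then show "2 ^ X \<omega> = (\<Sum>k\<le>n. 2 ^ k * indicator {\<omega> \<in> space M. X \<omega> = k} \<omega> :: real)"
      using X[of \<omega>] by simp
  qed simp
  also have "\<dots> = (\<Sum>k\<le>n. 2 ^ k * prob {\<omega> \<in> space M. X \<omega> = k})"
    by (rule expectation_sum_indicator) measurable
  finally show ?thesis .
qed

section \<open>The gluing points lie on the trees\<close>

context aggregation
begin

lemma sigma_finite_past: "sigma_finite_subalgebra M (past M U n)"
proof (rule finite_measure_subalgebra_is_sigma_finite, unfold_locales)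
  let ?G = "{U k -` B \<inter> space M | k B. 1 \<le> k \<and> k < n \<and> B \<in> sets borel}"
  have "?G \<subseteq> sets M" using measurable_sets[OF glue_measurable] by auto
  then have "sigma_sets (space M) ?G \<subseteq> sets M" by (rule sets.sigma_sets_subset)
  moreover have "?G \<subseteq> Pow (space M)" by auto
  ultimately show "subalgebra M (past M U n)"
    by (simp add: subalgebra_def past_def)
qed

lemma integrable_glue_indicator:
  assumes "n \<ge> 1" "B \<in> sets borel"
  shows "integrable M (indicator (U n -` B \<inter> space M) :: _ \<Rightarrow> real)"
  using measurable_sets[OF glue_measurable] assms by (intro integrable_real_indicator) (auto simp: less_top[symmetric])

text \<open>
Averages the conditional law over the past. The uniform measure of \<open>B\<close> is not known to be a
measurable function of the outcome, so \<open>h\<close> stands for a measurable version of it.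
\<close>

lemma prob_glue:
  assumes n: "n \<ge> 1" and B: "B \<in> sets borel" and h: "h \<in> borel_measurable M"
    and eq: "AE \<omega> in M. measure (uniform_on_tree a (\<lambda>k. U k \<omega>) n) B = h \<omega>"
  shows "prob (U n -` B \<inter> space M) = (\<integral>\<omega>. h \<omega> \<partial>M)"
proof -
  interpret P: sigma_finite_subalgebra M "past M U n" by (rule sigma_finite_past)
  let ?f = "indicator (U n -` B \<inter> space M) :: _ \<Rightarrow> real"
  have "prob (U n -` B \<inter> space M) = (\<integral>\<omega>. ?f \<omega> \<partial>M)" by simp
  also have "\<dots> = (\<integral>\<omega>. real_cond_exp M (past M U n) ?f \<omega> \<partial>M)"
    by (rule P.real_cond_exp_int(2)[OF integrable_glue_indicator[OF n B], symmetric])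
  also have "\<dots> = (\<integral>\<omega>. h \<omega> \<partial>M)"
  proof (rule integral_cong_AE)
    show "AE \<omega> in M. real_cond_exp M (past M U n) ?f \<omega> = h \<omega>"
      using glue_uniform[OF n B] eq by eventually_elim simp
  qed (simp_all add: h)
  finally show ?thesis .
qed

text \<open>
The event that the conditional probability vanishes belongs to the past, and on it the
gluing point hits \<open>B\<close> with probability \<open>0\<close>.
\<close>

lemma AE_charged_if_hit:
  assumes n: "n \<ge> 1" and B: "B \<in> sets borel"
  shows "AE \<omega> in M. U n \<omega> \<in> B \<longrightarrow> measure (uniform_on_tree a (\<lambda>k. U k \<omega>) n) B \<noteq> 0"
proof -
  interpret P: sigma_finite_subalgebra M "past M U n" by (rule sigma_finite_past)
  let ?f = "indicator (U n -` B \<inter> space M) :: _ \<Rightarrow> real"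
  define c where "c = real_cond_exp M (past M U n) ?f"
  define Z where "Z = {\<omega> \<in> space M. c \<omega> = 0}"
  have sp: "space (past M U n) = space M" using P.subalg by (simp add: subalgebra_def)
  have ZF: "Z \<in> sets (past M U n)"
    unfolding Z_def c_def sp[symmetric] by measurable
  have ZM: "Z \<in> sets M" using ZF P.subalg by (auto simp: subalgebra_def)
  have UM: "U n -` B \<inter> space M \<in> sets M" using measurable_sets[OF glue_measurable[OF n] B] .
  have "prob (Z \<inter> (U n -` B \<inter> space M)) = (\<integral>\<omega>\<in>Z. ?f \<omega> \<partial>M)"
    using ZM UM by (simp add: set_lebesgue_integral_def flip: indicator_inter_arith)
  also have "\<dots> = (\<integral>\<omega>\<in>Z. c \<omega> \<partial>M)"
    unfolding c_def by (rule P.real_cond_exp_intA[OF integrable_glue_indicator[OF n B] ZF])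
  also have "\<dots> = (\<integral>\<omega>. 0 \<partial>M)"
    unfolding set_lebesgue_integral_def by (rule Bochner_Integration.integral_cong) (auto simp: Z_def indicator_def)
  finally have "prob (Z \<inter> (U n -` B \<inter> space M)) = 0" by simp
  then have "AE \<omega> in M. \<omega> \<notin> Z \<inter> (U n -` B \<inter> space M)"
    using ZM UM by (intro AE_not_in) (auto simp: null_sets_def emeasure_eq_measure)
  then show ?thesis using glue_uniform[OF n B] AE_space
    by eventually_elim (auto simp: Z_def c_def)
qed

text \<open>
Otherwise the gluing point would be in some small ball with rational centre that misses the closed set
\<open>agg_tree a u n\<close>; such a ball has measure \<open>0\<close>, and a ball of measure \<open>0\<close> is not hit. Using
countably many fixed balls avoids the measurability of the random tree.
\<close>

lemma AE_glue_in_tree: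
  assumes n: "n \<ge> 1"
  shows "AE \<omega> in M. U n \<omega> \<in> agg_tree a (\<lambda>k. U k \<omega>) n"
proof -
  have "AE \<omega> in M. \<forall>p\<in>rat_points. \<forall>j :: nat. U n \<omega> \<in> ball p (1 / Suc j) \<longrightarrow>
      measure (uniform_on_tree a (\<lambda>k. U k \<omega>) n) (ball p (1 / Suc j)) \<noteq> 0"
    by (intro AE_ball_countable[THEN iffD2] AE_all_countable[THEN iffD2] allI ballI countable_rat_points
        AE_charged_if_hit n) simp
  then show ?thesis
  proof eventually_elim
    case (elim \<omega>)
    let ?u = "\<lambda>k. U k \<omega>"
    show ?case
    proof (rule ccontr)
      assume "U n \<omega> \<notin> agg_tree a ?u n"
      then have "U n \<omega> \<in> - agg_tree a ?u n" "open (- agg_tree a ?u n)"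
        using compact_imp_closed[OF compact_agg_tree] by auto
      then obtain e where e: "0 < e" "ball (U n \<omega>) e \<subseteq> - agg_tree a ?u n" by (auto simp: open_contains_ball)
      obtain j where j: "1 / real (Suc j) < e / 2" using nat_approx_posE[of "e / 2"] e by auto
      obtain p where p: "p \<in> rat_points" "dist p (U n \<omega>) < 1 / real (Suc j)"
        using rat_points_dense[of "1 / real (Suc j)" "U n \<omega>"] by auto
      have "ball p (1 / Suc j) \<subseteq> ball (U n \<omega>) e"
      proof
        fix y assume "y \<in> ball p (1 / Suc j)"
        then show "y \<in> ball (U n \<omega>) e" using p(2) j dist_triangle3[of "U n \<omega>" y p] by auto
      qed
      then have "{0..a (Suc i)} \<inter> branch_point ?u i -` ball p (1 / Suc j) = {}" if "i < n" for i
        using branch_subset_agg_tree[OF that, of ?u a] e(2) by blast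
      then have "measure (uniform_on_tree a ?u n) (ball p (1 / Suc j)) = 0"
        by (subst measure_uniform_on_tree[OF length_pos n]) auto
      then show False using elim p by auto
    qed
  qed
qed

lemma AE_growing_tree: "AE \<omega> in M. growing_tree a (\<lambda>k. U k \<omega>)"
proof -
  have "AE \<omega> in M. \<forall>n. n \<ge> 1 \<longrightarrow> U n \<omega> \<in> agg_tree a (\<lambda>k. U k \<omega>) n"
    using AE_glue_in_tree by (auto simp: AE_all_countable)
  then show ?thesis by eventually_elim (simp add: growing_tree_def length_pos)
qed

section \<open>Exponential moments of the generations\<close>

definition gen :: "nat \<Rightarrow> 'w \<Rightarrow> nat" where
  "gen n \<omega> = nnz n (glue_point (\<lambda>k. U k \<omega>) n)"

lemma gen_measurable [measurable]: "gen n \<in> measurable M (count_space UNIV)"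
proof (cases "n = 0")
  case False
  then have [measurable]: "U n \<in> borel_measurable M" by (intro glue_measurable) simp
  show ?thesis using False unfolding gen_def[abs_def] glue_point_def by simp
qed (simp add: gen_def[abs_def])

lemma gen_le: "gen n \<omega> \<le> n"
  by (simp add: gen_def nnz_le)

lemma prob_gen:
  assumes n: "n \<ge> 1"
  shows "prob {\<omega> \<in> space M. gen n \<omega> = k} =
    (\<Sum>i<n. a (Suc i) * prob {\<omega> \<in> space M. gen i \<omega> + 1 = k}) / (\<Sum>i<n. a (Suc i))"
proof -
  define h where "h \<omega> = (\<Sum>i<n. a (Suc i) * indicator {\<omega> \<in> space M. gen i \<omega> + 1 = k} \<omega>) / (\<Sum>i<n. a (Suc i))" for \<omega>
  have "AE \<omega> in M. measure (uniform_on_tree a (\<lambda>k. U k \<omega>) n) {x. nnz n x = k} = h \<omega>"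
    using AE_growing_tree AE_space
  proof eventually_elim
    case (elim \<omega>)
    then show ?case
      using growing_tree.measure_uniform_on_tree_nnz[OF elim(1) n, of k] by (simp add: h_def gen_def indicator_def)
  qed
  moreover have "h \<in> borel_measurable M" unfolding h_def[abs_def] by measurable
  ultimately have "prob (U n -` {x. nnz n x = k} \<inter> space M) = (\<integral>\<omega>. h \<omega> \<partial>M)"
    by (intro prob_glue n) measurable
  also have "U n -` {x. nnz n x = k} \<inter> space M = {\<omega> \<in> space M. gen n \<omega> = k}"
    using n by (auto simp: gen_def glue_point_def)
  also have "(\<integral>\<omega>. h \<omega> \<partial>M) = (\<Sum>i<n. a (Suc i) * prob {\<omega> \<in> space M. gen i \<omega> + 1 = k}) / (\<Sum>i<n. a (Suc i))"
    unfolding h_def[abs_def] integral_divide_zero by (subst expectation_sum_indicator) auto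
  finally show ?thesis .
qed

lemma integrable_power_gen: "integrable M (\<lambda>\<omega>. 2 ^ gen n \<omega> :: real)"
  by (rule integrable_const_bound[of _ "2 ^ n"]) (auto simp: gen_le power_increasing)

text \<open>
The uniform point lies on branch \<open>i + 1\<close> with probability proportional to \<open>a (Suc i)\<close>, and then its
generation is \<open>gen i + 1\<close>, which doubles the power of two.
\<close>

lemma expectation_power_gen:
  assumes n: "n \<ge> 1"
  shows "(\<Sum>i<n. a (Suc i)) * expectation (\<lambda>\<omega>. 2 ^ gen n \<omega>) =
    (\<Sum>i<n. a (Suc i) * (2 * expectation (\<lambda>\<omega>. 2 ^ gen i \<omega>)))"
proof -
  let ?A = "\<Sum>i<n. a (Suc i)"
  have A: "0 < ?A" using n by (intro sum_pos length_pos) (auto simp: lessThan_empty_iff)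
  have "?A * expectation (\<lambda>\<omega>. 2 ^ gen n \<omega>) = ?A * (\<Sum>k\<le>n. 2 ^ k * prob {\<omega> \<in> space M. gen n \<omega> = k})"
    by (subst expectation_power_bounded[of _ n]) (simp_all add: gen_le)
  also have "\<dots> = (\<Sum>k\<le>n. 2 ^ k * (?A * prob {\<omega> \<in> space M. gen n \<omega> = k}))"
    by (simp add: sum_distrib_left mult.left_commute)
  also have "\<dots> = (\<Sum>k\<le>n. 2 ^ k * (\<Sum>i<n. a (Suc i) * prob {\<omega> \<in> space M. gen i \<omega> + 1 = k}))"
    using A unfolding prob_gen[OF n] by simp
  also have "\<dots> = (\<Sum>k\<le>n. \<Sum>i<n. a (Suc i) * (2 ^ k * prob {\<omega> \<in> space M. gen i \<omega> + 1 = k}))"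
    by (simp add: sum_distrib_left mult.left_commute)
  also have "\<dots> = (\<Sum>i<n. a (Suc i) * (\<Sum>k\<le>n. 2 ^ k * prob {\<omega> \<in> space M. gen i \<omega> + 1 = k}))"
    by (subst sum.swap) (simp add: sum_distrib_left)
  also have "\<dots> = (\<Sum>i<n. a (Suc i) * expectation (\<lambda>\<omega>. 2 ^ (gen i \<omega> + 1)))"
  proof (intro sum.cong refl arg_cong2[where f = "(*)"] expectation_power_bounded[symmetric])
    fix i \<omega> assume "i \<in> {..<n}"
    then show "gen i \<omega> + 1 \<le> n" using gen_le[of i \<omega>] by simp
  qed measurable
  finally show ?thesis by simp
qed

text \<open>
Subtracting two consecutive cases of the recursion gives
\<open>A\<^bsub>n+1\<^esub> F\<^bsub>n+1\<^esub> = (A\<^sub>n + 2 a\<^bsub>n+1\<^esub>) F\<^sub>n\<close>, and \<open>(A\<^sub>n + 2 a\<^bsub>n+1\<^esub>) A\<^sub>n \<le> A\<^bsub>n+1\<^esub>\<^sup>2\<close>. The base 2 of the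
powers is what makes this last inequality hold.
\<close>

lemma expectation_power_gen_le:
  assumes n: "n \<ge> 1"
  shows "expectation (\<lambda>\<omega>. 2 ^ gen n \<omega>) \<le> 2 / a 1 * (\<Sum>i<n. a (Suc i))"
  using n
proof (induction n rule: nat_induct_at_least)
  case base
  have "gen 0 \<omega> = 0" for \<omega> using gen_le[of 0 \<omega>] by simp
  then show ?case
    using expectation_power_gen[of 1] length_pos[of 1] by (simp add: lessThan_Suc prob_space)
next
  case (Suc n)
  let ?A = "\<Sum>i<n. a (Suc i)" and ?F = "\<lambda>n. expectation (\<lambda>\<omega>. 2 ^ gen n \<omega> :: real)"
  have A: "0 < ?A" using Suc.hyps by (intro sum_pos length_pos) (auto simp: lessThan_empty_iff)
  have a: "0 < a (Suc n)" "0 < a 1" by (auto intro: length_pos)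
  have "(?A + a (Suc n)) * ?F (Suc n) = (?A + 2 * a (Suc n)) * ?F n"
    using expectation_power_gen[of "Suc n"] expectation_power_gen[OF Suc.hyps] by (simp add: algebra_simps)
  also have "\<dots> \<le> (?A + 2 * a (Suc n)) * (2 / a 1 * ?A)"
    using A a by (intro mult_left_mono Suc.IH) auto
  also have "\<dots> \<le> (?A + a (Suc n)) * (2 / a 1 * (?A + a (Suc n)))"
    using A a by (simp add: field_simps)
  finally have "?F (Suc n) \<le> 2 / a 1 * (?A + a (Suc n))"
    by (rule mult_left_le_imp_le) (use A a in simp)
  then show ?case by simp
qed

text \<open>
The means of \<open>2\<^bsup>G\<^sub>n\<^esup> / n\<^sup>3\<close> are \<open>O(n\<^bsup>-2\<^esup>)\<close>, so the sum of these variables is integrable, hence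
almost surely finite, and it bounds each of its terms.
\<close>

lemma AE_gen_growth:
  assumes D: "\<And>i. i \<ge> 1 \<Longrightarrow> a i \<le> D"
  shows "AE \<omega> in M. \<exists>C. \<forall>n\<ge>1. 2 ^ nnz n (U n \<omega>) \<le> C * real n ^ 3"
proof -
  define f where "f n \<omega> = (2 ^ gen (Suc n) \<omega> / real (Suc n) ^ 3 :: real)" for n \<omega>
  have [measurable]: "f n \<in> borel_measurable M" for n unfolding f_def[abs_def] by measurable
  have a1: "0 < a 1" by (rule length_pos) simp
  define c where "c = 2 / a 1 * D"
  have c: "0 \<le> c" using a1 D[of 1] by (simp add: c_def)
  have mean: "(\<integral>\<^sup>+\<omega>. ennreal (f n \<omega>) \<partial>M) \<le> ennreal (c * inverse (real (Suc n) ^ 2))" for n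
  proof -
    have "expectation (\<lambda>\<omega>. 2 ^ gen (Suc n) \<omega>) \<le> 2 / a 1 * (\<Sum>i<Suc n. a (Suc i))"
      by (rule expectation_power_gen_le) simp
    also have "\<dots> \<le> 2 / a 1 * (\<Sum>i<Suc n. D)"
      using a1 D by (intro mult_left_mono sum_mono) auto
    also have "\<dots> = c * real (Suc n)" by (simp add: c_def)
    finally have "expectation (\<lambda>\<omega>. 2 ^ gen (Suc n) \<omega>) / real (Suc n) ^ 3 \<le> c * real (Suc n) / real (Suc n) ^ 3"
      by (rule divide_right_mono) simp
    also have "\<dots> = c * inverse (real (Suc n) ^ 2)" by (simp add: power3_eq_cube power2_eq_square divide_inverse)
    finally have "expectation (f n) \<le> c * inverse (real (Suc n) ^ 2)" by (simp add: f_def[abs_def])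
    moreover have "integrable M (f n)" unfolding f_def[abs_def] using integrable_power_gen by simp
    ultimately show ?thesis
      by (subst nn_integral_eq_integral) (auto simp: f_def intro!: ennreal_leI)
  qed
  have "(\<integral>\<^sup>+\<omega>. (\<Sum>n. ennreal (f n \<omega>)) \<partial>M) = (\<Sum>n. \<integral>\<^sup>+\<omega>. ennreal (f n \<omega>) \<partial>M)"
    by (rule nn_integral_suminf) simp
  also have "\<dots> \<le> (\<Sum>n. ennreal (c * inverse (real (Suc n) ^ 2)))"
    by (intro suminf_le mean) auto
  also have "\<dots> < top"
  proof -
    have "summable (\<lambda>n. c * inverse (real (Suc n) ^ 2))"
      using inverse_power_summable[of 2, where 'a = real] summable_Suc_iff[of "\<lambda>n. inverse (real n ^ 2)"]
      by (intro summable_mult) simp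
    then have "(\<Sum>n. ennreal (c * inverse (real (Suc n) ^ 2))) = ennreal (\<Sum>n. c * inverse (real (Suc n) ^ 2))"
      using c by (intro suminf_ennreal2) auto
    then show ?thesis by simp
  qed
  finally have "AE \<omega> in M. (\<Sum>n. ennreal (f n \<omega>)) \<noteq> \<infinity>"
    by (intro nn_integral_PInf_AE) auto
  then show ?thesis
  proof eventually_elim
    case (elim \<omega>)
    then obtain C where C: "(\<Sum>n. ennreal (f n \<omega>)) = ennreal C" "0 \<le> C"
      by (cases "\<Sum>n. ennreal (f n \<omega>)") auto
    have "2 ^ nnz n (U n \<omega>) \<le> C * real n ^ 3" if n: "n \<ge> 1" for n
    proof -
      obtain m where m: "n = Suc m" using n by (cases n) auto
      have "ennreal (f m \<omega>) \<le> ennreal C"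
        using sum_le_suminf[of "\<lambda>n. ennreal (f n \<omega>)" "{m}"] C(1) by simp
      then have "f m \<omega> \<le> C" using C(2) by simp
      then show ?thesis by (simp add: f_def m gen_def glue_point_def field_simps)
    qed
    then show ?case by blast
  qed
qed

end

theorem proposition10:
  fixes M :: "'w measure" and a :: "nat \<Rightarrow> real" and U :: "nat \<Rightarrow> 'w \<Rightarrow> ell1" and \<alpha> :: real
  assumes "aggregation M a U"
    and "0 < \<alpha>" and "\<alpha> \<le> 1"
    and "\<forall>\<epsilon>>0. \<forall>\<^sub>F i in sequentially. a i \<le> real i powr (- \<alpha> + \<epsilon>)"
  shows "AE \<omega> in M.
    let T = limit_tree a (\<lambda>n. U n \<omega>); d = length_dist T
    in compact_space (Metric_space.mtopology T d) \<and> hausdorff_dim T d \<le> ennreal (1 / \<alpha>)"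
proof -
  interpret aggregation M a U by fact
  \<comment> \<open>The lengths are bounded: the hypothesis with \<open>\<epsilon> = \<alpha>\<close>.\<close>
  have "\<forall>\<^sub>F i in sequentially. a i \<le> real i powr (- 0)"
    using assms(4)[rule_format, of \<alpha>] assms(2) by simp
  then obtain D where D: "0 < D" "\<And>i. i \<ge> 1 \<Longrightarrow> a i \<le> D * real i powr (- 0)"
    using power_decay_bound[of a, OF length_pos] by blast
  have "a i \<le> D" if "i \<ge> 1" for i using D(2) that by auto
  then have "AE \<omega> in M. \<exists>C. \<forall>n\<ge>1. 2 ^ nnz n (U n \<omega>) \<le> C * real n ^ 3"
    by (rule AE_gen_growth)
  then show ?thesis using AE_growing_tree
  proof eventually_elim
    case (elim \<omega>)
    then obtain C where C: "\<And>n. n \<ge> 1 \<Longrightarrow> 2 ^ nnz n (U n \<omega>) \<le> C * real n ^ 3" by blast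
    interpret growing_tree a "\<lambda>k. U k \<omega>" by (rule elim(2))
    have "compact_space (Metric_space.mtopology T (length_dist T))"
      using compact_limit_tree[OF C assms(2-4)]
      by (simp add: mtopology_of_induced_metric[OF length_dist_limit_tree] compact_space_subtopology)
    moreover have "hausdorff_dim T (length_dist T) \<le> ennreal (1 / \<alpha>)"
      by (rule hausdorff_dim_limit_tree_le[OF C assms(2-4)]) (simp_all add: length_dist_limit_tree)
    ultimately show ?case by (simp add: Let_def)
  qed
qed

end
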